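(* Let $C_{w,f}$ be a weighted composition operator on $L^p(\mu)$, and let $\mathfrak{X}$ be the closed subspace of $L^p(\mu)$ generated by (i.e. the closed linear span of) the characteristic functions $\chi_B$ such that $B$ is a measurable set of finite $\mu$-measure satisfying \[ \liminf_{n \to \infty} \mu_n(f^{-n}(B)) = 0. \] Then $C_{w,f}$ is Li-Yorke chaotic if and only if it is not power-bounded in $\mathfrak{X}$.
   Context: Fix $\mathbb{K} = \mathbb{R}$ or $\mathbb{C}$, a real number $p \in [1,\infty)$ and an arbitrary positive measure space $(X,\mathfrak{M},\mu)$. $L^p(\mu)$ is the Banach space over $\mathbb{K}$ of all $\mathbb{K}$-valued $p$-integrable functions with norm $\|\varphi\|_p = (\int_X |\varphi|^p d\mu)^{1/p}$. A weighted composition operator on $L^p(\mu)$ is the map $C_{w,f}(\varphi) = (\varphi \circ f)\cdot w$, where $w : X \to \mathbb{K}$ is measurable with $\varphi\cdot w \in L^p(\mu)$ for all $\varphi \in L^p(\mu)$, $f : X \to X$ is bimeasurable (i.e. $f(B) \in \mathfrak{M}$ and $f^{-1}(B) \in \mathfrak{M}$ whenever $B \in \mathfrak{M}$), and there is a constant $c \in (0,\infty)$ such that $\int_B |w|^p d\mu \le c\,\mu(f(B))$ for every $B \in \mathfrak{M}$; these conditions make $C_{w,f}$ a well-defined bounded linear operator on $L^p(\mu)$. Put $w^{(1)} = w$, $w^{(n)} = (w\circ f^{n-1})\cdots(w\circ f)\cdot w$ for $n \ge 2$, and $\mu_n(B) = \int_B |w^{(n)}|^p d\mu$ for $B \in \mathfrak{M}$,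 $n \in \mathbb{N} = \{1,2,\ldots\}$. Given an operator $T$ on a Banach space $Y$ and a subspace $Z$ of $Y$, $T$ is power-bounded in $Z$ if there is $C \in (0,\infty)$ with $\|T^n|_Z\| \le C$ for all $n \in \mathbb{N}$, where $T^n|_Z : Z \to Y$ is the restriction of $T^n$ to $Z$. A map $g : M \to M$ on a metric space $(M,d)$ is Li-Yorke chaotic if there is an uncountable set $S \subset M$ such that for each pair $(x,y)$ of distinct points of $S$: $\liminf_{n\to\infty} d(g^n(x),g^n(y)) = 0$ and $\limsup_{n\to\infty} d(g^n(x),g^n(y)) > 0$. *)

theory Defs
  imports "HOL-Analysis.Analysis"
begin

section \<open>The Banach space of p-integrable functions\<close>

text \<open>The measure space is \<open>(space M, sets M, M)\<close>. Functions agreeing almost everywhere are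
  identified, so values outside \<open>space M\<close> play no role. The scalar type \<open>'k\<close> is meant to be
  \<^typ>\<open>real\<close> or \<^typ>\<open>complex\<close>.\<close>

definition lp_fun :: "real \<Rightarrow> 'a measure \<Rightarrow> ('a \<Rightarrow> 'k::{real_normed_field,second_countable_topology}) set"
  where "lp_fun p M = {\<phi> \<in> borel_measurable M. integrable M (\<lambda>x. norm (\<phi> x) powr p)}"

definition lp_norm :: "real \<Rightarrow> 'a measure \<Rightarrow> ('a \<Rightarrow> 'k::{real_normed_field,second_countable_topology}) \<Rightarrow> real"
  where "lp_norm p M \<phi> = (\<integral>x. norm (\<phi> x) powr p \<partial>M) powr (1 / p)"

definition lp_rel :: "real \<Rightarrow> 'a measure \<Rightarrow> ('a \<Rightarrow> 'k::{real_normed_field,second_countable_topology}) rel"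
  where "lp_rel p M = {(\<phi>, \<psi>). \<phi> \<in> lp_fun p M \<and> \<psi> \<in> lp_fun p M \<and> (AE x in M. \<phi> x = \<psi> x)}"

definition lp_class :: "real \<Rightarrow> 'a measure \<Rightarrow> ('a \<Rightarrow> 'k::{real_normed_field,second_countable_topology}) \<Rightarrow> ('a \<Rightarrow> 'k) set"
  where "lp_class p M \<phi> = lp_rel p M `` {\<phi>}"

definition Lp :: "real \<Rightarrow> 'a measure \<Rightarrow> ('a \<Rightarrow> 'k::{real_normed_field,second_countable_topology}) set set"
  where "Lp p M = lp_fun p M // lp_rel p M"

definition lp_rep :: "('a \<Rightarrow> 'k) set \<Rightarrow> 'a \<Rightarrow> 'k"
  where "lp_rep A = (SOME \<phi>. \<phi> \<in> A)"

definition Lp_norm :: "real \<Rightarrow> 'a measure \<Rightarrow> ('a \<Rightarrow> 'k::{real_normed_field,second_countable_topology}) set \<Rightarrow> real"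
  where "Lp_norm p M A = lp_norm p M (lp_rep A)"

definition Lp_dist :: "real \<Rightarrow> 'a measure \<Rightarrow> ('a \<Rightarrow> 'k::{real_normed_field,second_countable_topology}) set \<Rightarrow> ('a \<Rightarrow> 'k) set \<Rightarrow> real"
  where "Lp_dist p M A B = lp_norm p M (\<lambda>x. lp_rep A x - lp_rep B x)"

text \<open>\<open>G\<close> is a set of p-integrable functions; linear combinations take their coefficients in \<open>'k\<close>.
  See \<open>Metric_space_Lp\<close> below.\<close>

definition Lp_closed_span :: "real \<Rightarrow> 'a measure \<Rightarrow> ('a \<Rightarrow> 'k::{real_normed_field,second_countable_topology}) set \<Rightarrow> ('a \<Rightarrow> 'k) set set"
  where "Lp_closed_span p M G =
    Metric_space.mtopology (Lp p M) (Lp_dist p M) closure_of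
      (lp_class p M ` {(\<lambda>x. \<Sum>\<phi>\<in>F. c \<phi> * \<phi> x) | F c. finite F \<and> F \<subseteq> G})"

text \<open>The lemmas \<open>Lp_norm_class\<close>, \<open>Lp_dist_class\<close> and \<open>Metric_space_Lp\<close> show that norm and
  distance do not depend on the choice of representatives and that the metric topology is the intended one.\<close>

lemma lp_fun_zero: "(\<lambda>x. 0) \<in> lp_fun p M"
  by (simp add: lp_fun_def)

lemma lp_fun_scale:
  assumes "\<phi> \<in> lp_fun p M"
  shows "(\<lambda>x. c * \<phi> x) \<in> lp_fun p M"
  using assms by (auto simp: lp_fun_def norm_mult powr_mult)

lemma convex_powr_bound:
  fixes a b t p :: real
  assumes "1 \<le> p" "0 \<le> a" "0 \<le> b" "0 \<le> t" "t \<le> 1"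
  shows "(t * a + (1 - t) * b) powr p \<le> t * a powr p + (1 - t) * b powr p"
proof -
  have shrink: "(u * z) powr p \<le> u * z powr p" if "0 \<le> u" "u \<le> 1" "0 \<le> z" for u z :: real
  proof -
    have "u powr p \<le> u"
      using powr_mono'[of 1 p u] that assms(1) by (cases "u = 0") auto
    then have "u powr p * z powr p \<le> u * z powr p" by (intro mult_right_mono) auto
    then show ?thesis using that by (simp add: powr_mult)
  qed
  consider "a = 0" | "b = 0" | "0 < a" "0 < b" using assms by linarith
  then show ?thesis
  proof cases
    case 1
    then show ?thesis using shrink[of "1 - t" b] assms by simp
  next
    case 2
    then show ?thesis using shrink[of t a] assms by simp
  next
    case 3
    then show ?thesis
      using convex_onD[OF powr_convex[OF assms(1)], of "1 - t" a b] assms by simp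
  qed
qed

lemma lp_fun_add:
  assumes p: "1 \<le> p" and f: "\<phi> \<in> lp_fun p M" and g: "\<psi> \<in> lp_fun p M"
  shows "(\<lambda>x. \<phi> x + \<psi> x) \<in> lp_fun p M"
proof -
  have m [measurable]: "\<phi> \<in> borel_measurable M" "\<psi> \<in> borel_measurable M"
    using f g by (auto simp: lp_fun_def)
  have "integrable M (\<lambda>x. norm (\<phi> x + \<psi> x) powr p)"
  proof (rule Bochner_Integration.integrable_bound)
    show "integrable M (\<lambda>x. 2 powr p * (norm (\<phi> x) powr p + norm (\<psi> x) powr p))"
      using f g by (auto simp: lp_fun_def)
    have "norm (\<phi> x + \<psi> x) powr p \<le> 2 powr p * (norm (\<phi> x) powr p + norm (\<psi> x) powr p)" for x
    proof -
      have "norm (\<phi> x + \<psi> x) powr p \<le> (2 * (1/2 * norm (\<phi> x) + (1 - 1/2) * norm (\<psi> x))) powr p"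
        using p norm_triangle_ineq[of "\<phi> x" "\<psi> x"] by (intro powr_mono2) auto
      also have "\<dots> = 2 powr p * (1/2 * norm (\<phi> x) + (1 - 1/2) * norm (\<psi> x)) powr p"
        by (subst powr_mult) auto
      also have "\<dots> \<le> 2 powr p * (1/2 * norm (\<phi> x) powr p + (1 - 1/2) * norm (\<psi> x) powr p)"
        using convex_powr_bound[OF p, of "norm (\<phi> x)" "norm (\<psi> x)" "1/2"] by (intro mult_left_mono) auto
      also have "\<dots> \<le> 2 powr p * (norm (\<phi> x) powr p + norm (\<psi> x) powr p)"
        by (intro mult_left_mono add_mono) (auto intro: mult_left_le_one_le)
      finally show ?thesis .
    qed
    then show "AE x in M. norm (norm (\<phi> x + \<psi> x) powr p)
        \<le> norm (2 powr p * (norm (\<phi> x) powr p + norm (\<psi> x) powr p))"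
      by (auto simp: abs_mult)
  qed measurable
  then show ?thesis by (simp add: lp_fun_def)
qed

lemma lp_fun_diff:
  assumes p: "1 \<le> p" and f: "\<phi> \<in> lp_fun p M" and g: "\<psi> \<in> lp_fun p M"
  shows "(\<lambda>x. \<phi> x - \<psi> x) \<in> lp_fun p M"
  using lp_fun_add[OF p f lp_fun_scale[OF g, of "- 1"]] by simp

lemma lp_norm_nonneg: "0 \<le> lp_norm p M \<phi>"
  by (simp add: lp_norm_def)

lemma lp_norm_powr:
  assumes "1 \<le> p"
  shows "lp_norm p M \<phi> powr p = (\<integral>x. norm (\<phi> x) powr p \<partial>M)"
  using assms by (simp add: lp_norm_def powr_powr)

lemma lp_norm_eq_0:
  assumes p: "1 \<le> p" and f: "\<phi> \<in> lp_fun p M"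
  shows "lp_norm p M \<phi> = 0 \<longleftrightarrow> (AE x in M. \<phi> x = 0)"
proof -
  have "lp_norm p M \<phi> = 0 \<longleftrightarrow> (\<integral>x. norm (\<phi> x) powr p \<partial>M) = 0"
    by (simp add: lp_norm_def)
  also have "\<dots> \<longleftrightarrow> (AE x in M. norm (\<phi> x) powr p = 0)"
    using f by (intro integral_nonneg_eq_0_iff_AE) (auto simp: lp_fun_def)
  finally show ?thesis by simp
qed

lemma lp_norm_cong_AE:
  assumes "\<phi> \<in> borel_measurable M" "\<psi> \<in> borel_measurable M" "AE x in M. \<phi> x = \<psi> x"
  shows "lp_norm p M \<phi> = lp_norm p M \<psi>"
proof -
  have "(\<integral>x. norm (\<phi> x) powr p \<partial>M) = (\<integral>x. norm (\<psi> x) powr p \<partial>M)"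
    using assms by (intro integral_cong_AE) auto
  then show ?thesis by (simp add: lp_norm_def)
qed

lemma lp_norm_triangle:
  assumes p: "1 \<le> p" and f: "\<phi> \<in> lp_fun p M" and g: "\<psi> \<in> lp_fun p M"
  shows "lp_norm p M (\<lambda>x. \<phi> x + \<psi> x) \<le> lp_norm p M \<phi> + lp_norm p M \<psi>"
proof -
  have m [measurable]: "\<phi> \<in> borel_measurable M" "\<psi> \<in> borel_measurable M"
    using f g by (auto simp: lp_fun_def)
  have i: "integrable M (\<lambda>x. norm (\<phi> x) powr p)" "integrable M (\<lambda>x. norm (\<psi> x) powr p)"
    "integrable M (\<lambda>x. norm (\<phi> x + \<psi> x) powr p)"
    using f g lp_fun_add[OF p f g] by (auto simp: lp_fun_def)
  let ?a = "lp_norm p M \<phi>" and ?b = "lp_norm p M \<psi>"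
  consider "?a = 0" | "?b = 0" | "0 < ?a" "0 < ?b"
    using lp_norm_nonneg by (metis less_eq_real_def)
  then show ?thesis
  proof cases
    case 1
    then have "AE x in M. \<phi> x + \<psi> x = \<psi> x" using lp_norm_eq_0[OF p f] by auto
    then have "lp_norm p M (\<lambda>x. \<phi> x + \<psi> x) = ?b" by (intro lp_norm_cong_AE) auto
    then show ?thesis using 1 by simp
  next
    case 2
    then have "AE x in M. \<phi> x + \<psi> x = \<phi> x" using lp_norm_eq_0[OF p g] by auto
    then have "lp_norm p M (\<lambda>x. \<phi> x + \<psi> x) = ?a" by (intro lp_norm_cong_AE) auto
    then show ?thesis using 2 by simp
  next
    case 3
    define s where "s = ?a + ?b"
    define t where "t = ?a / s"
    have s: "s > 0" and t: "0 \<le> t" "t \<le> 1" and t': "1 - t = ?b / s"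
      using 3 by (simp_all add: s_def t_def diff_divide_eq_iff)
    have pw: "norm (\<phi> x + \<psi> x) powr p
      \<le> s powr p * (t * (norm (\<phi> x) powr p / ?a powr p) + (1 - t) * (norm (\<psi> x) powr p / ?b powr p))" for x
    proof -
      have "norm (\<phi> x) + norm (\<psi> x) = s * (t * (norm (\<phi> x) / ?a) + (1 - t) * (norm (\<psi> x) / ?b))"
        using 3 s by (simp add: t' distrib_left) (simp add: t_def)
      then have "norm (\<phi> x + \<psi> x) powr p
          \<le> (s * (t * (norm (\<phi> x) / ?a) + (1 - t) * (norm (\<psi> x) / ?b))) powr p"
        using p norm_triangle_ineq[of "\<phi> x" "\<psi> x"] by (intro powr_mono2) auto
      also have "\<dots> = s powr p * (t * (norm (\<phi> x) / ?a) + (1 - t) * (norm (\<psi> x) / ?b)) powr p"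
        using 3 s t by (subst powr_mult) auto
      also have "\<dots> \<le> s powr p * (t * (norm (\<phi> x) / ?a) powr p + (1 - t) * (norm (\<psi> x) / ?b) powr p)"
        using 3 t by (intro mult_left_mono convex_powr_bound[OF p]) auto
      finally show ?thesis using 3 by (simp add: powr_divide)
    qed
    have "(\<integral>x. norm (\<phi> x + \<psi> x) powr p \<partial>M)
      \<le> (\<integral>x. s powr p * (t * (norm (\<phi> x) powr p / ?a powr p) + (1 - t) * (norm (\<psi> x) powr p / ?b powr p)) \<partial>M)"
      using i pw by (intro integral_mono) auto
    also have "\<dots> = s powr p * (t * (?a powr p / ?a powr p) + (1 - t) * (?b powr p / ?b powr p))"
      using i by (simp add: lp_norm_powr[OF p])
    also have "\<dots> = s powr p" using 3 by simp
    finally have "(\<integral>x. norm (\<phi> x + \<psi> x) powr p \<partial>M) powr (1 / p) \<le> (s powr p) powr (1 / p)"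
      using p by (intro powr_mono2) auto
    then show ?thesis using p s by (simp add: lp_norm_def[of p M "\<lambda>x. \<phi> x + \<psi> x"] powr_powr s_def)
  qed
qed

lemma equiv_lp_rel:
  "equiv (lp_fun p M) (lp_rel p M :: ('a \<Rightarrow> 'k::{real_normed_field,second_countable_topology}) rel)"
proof (rule equivI)
  show "lp_rel p M \<subseteq> lp_fun p M \<times> lp_fun p M" by (auto simp: lp_rel_def)
  show "refl_on (lp_fun p M) (lp_rel p M)" by (auto simp: lp_rel_def refl_on_def)
  show "sym (lp_rel p M)" by (auto simp: lp_rel_def sym_def eq_commute)
  show "trans (lp_rel p M :: ('a \<Rightarrow> 'k) rel)"
  proof (rule transI)
    fix a b c :: "'a \<Rightarrow> 'k"
    assume ab: "(a, b) \<in> lp_rel p M" and bc: "(b, c) \<in> lp_rel p M"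
    from ab bc have "AE x in M. a x = b x" "AE x in M. b x = c x" by (auto simp: lp_rel_def)
    then have "AE x in M. a x = c x" by eventually_elim simp
    with ab bc show "(a, c) \<in> lp_rel p M" by (auto simp: lp_rel_def)
  qed
qed

lemma lp_rep:
  assumes "A \<in> Lp p M"
  shows "lp_rep A \<in> lp_fun p M" "lp_class p M (lp_rep A) = A"
proof -
  have "A \<noteq> {}" using assms in_quotient_imp_non_empty[OF equiv_lp_rel] by (auto simp: Lp_def)
  then have r: "lp_rep A \<in> A" by (simp add: lp_rep_def some_in_eq)
  then show "lp_rep A \<in> lp_fun p M"
    using assms in_quotient_imp_subset[OF equiv_lp_rel] by (auto simp: Lp_def)
  show "lp_class p M (lp_rep A) = A"
    using assms[unfolded Lp_def] unfolding lp_class_def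
    by (rule quotientE) (use r equiv_class_eq[OF equiv_lp_rel] in blast)
qed

lemma lp_class_in_Lp: "\<phi> \<in> lp_fun p M \<Longrightarrow> lp_class p M \<phi> \<in> Lp p M"
  by (simp add: Lp_def lp_class_def quotientI)

lemma lp_class_eq_iff:
  assumes "\<phi> \<in> lp_fun p M" "\<psi> \<in> lp_fun p M"
  shows "lp_class p M \<phi> = lp_class p M \<psi> \<longleftrightarrow> (AE x in M. \<phi> x = \<psi> x)"
  using assms eq_equiv_class_iff[OF equiv_lp_rel assms] by (simp add: lp_class_def lp_rel_def)

lemma lp_rep_class:
  assumes "\<phi> \<in> lp_fun p M"
  shows "AE x in M. lp_rep (lp_class p M \<phi>) x = \<phi> x"
  using lp_rep[OF lp_class_in_Lp[OF assms]] lp_class_eq_iff assms by blast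

lemma Lp_norm_class:
  assumes "\<phi> \<in> lp_fun p M"
  shows "Lp_norm p M (lp_class p M \<phi>) = lp_norm p M \<phi>"
  unfolding Lp_norm_def using lp_rep(1)[OF lp_class_in_Lp[OF assms]] assms lp_rep_class[OF assms]
  by (intro lp_norm_cong_AE) (auto simp: lp_fun_def)

lemma Lp_dist_class:
  assumes f: "\<phi> \<in> lp_fun p M" and g: "\<psi> \<in> lp_fun p M"
  shows "Lp_dist p M (lp_class p M \<phi>) (lp_class p M \<psi>) = lp_norm p M (\<lambda>x. \<phi> x - \<psi> x)"
  unfolding Lp_dist_def
proof (rule lp_norm_cong_AE)
  show "AE x in M. lp_rep (lp_class p M \<phi>) x - lp_rep (lp_class p M \<psi>) x = \<phi> x - \<psi> x"
    using lp_rep_class[OF f] lp_rep_class[OF g] by eventually_elim simp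
qed (use f g lp_rep(1)[OF lp_class_in_Lp[OF f]] lp_rep(1)[OF lp_class_in_Lp[OF g]] in
    \<open>auto simp: lp_fun_def\<close>)

lemma Metric_space_Lp:
  assumes p: "1 \<le> p"
  shows "Metric_space (Lp p M :: ('a \<Rightarrow> 'k::{real_normed_field,second_countable_topology}) set set) (Lp_dist p M)"
proof
  fix A B C :: "('a \<Rightarrow> 'k) set"
  show "0 \<le> Lp_dist p M A B" by (simp add: Lp_dist_def lp_norm_nonneg)
  show "Lp_dist p M A B = Lp_dist p M B A" by (simp add: Lp_dist_def lp_norm_def norm_minus_commute)
  assume A: "A \<in> Lp p M" and B: "B \<in> Lp p M"
  note r = lp_rep[OF A] lp_rep[OF B]
  show "Lp_dist p M A B = 0 \<longleftrightarrow> A = B"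
    using lp_class_eq_iff[OF r(1) r(3)] lp_norm_eq_0[OF p lp_fun_diff[OF p r(1) r(3)]] r
    by (simp add: Lp_dist_def)
  assume C: "C \<in> Lp p M"
  show "Lp_dist p M A C \<le> Lp_dist p M A B + Lp_dist p M B C"
    using lp_norm_triangle[OF p lp_fun_diff[OF p r(1) r(3)] lp_fun_diff[OF p r(3) lp_rep(1)[OF C]]]
    by (simp add: Lp_dist_def)
qed

section \<open>Weighted composition operators\<close>

definition weighted_composition ::
    "real \<Rightarrow> 'a measure \<Rightarrow> ('a \<Rightarrow> 'k::{real_normed_field,second_countable_topology}) \<Rightarrow> ('a \<Rightarrow> 'a) \<Rightarrow> bool"
  where "weighted_composition p M w f \<longleftrightarrow>
    w \<in> borel_measurable M \<and>
    (\<forall>\<phi>\<in>lp_fun p M. (\<lambda>x. \<phi> x * w x) \<in> lp_fun p M) \<and>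
    f \<in> measurable M M \<and> (\<forall>B\<in>sets M. f ` B \<in> sets M) \<and>
    (\<exists>c::real. 0 < c \<and>
      (\<forall>B\<in>sets M. (\<integral>\<^sup>+x\<in>B. ennreal (norm (w x) powr p) \<partial>M) \<le> ennreal c * emeasure M (f ` B)))"

definition wcomp :: "('a \<Rightarrow> 'k::{real_normed_field,second_countable_topology}) \<Rightarrow> ('a \<Rightarrow> 'a) \<Rightarrow> ('a \<Rightarrow> 'k) \<Rightarrow> 'a \<Rightarrow> 'k"
  where "wcomp w f \<phi> = (\<lambda>x. \<phi> (f x) * w x)"

text \<open>The induced map on classes; see \<open>Lp_wcomp_class\<close> below.\<close>

definition Lp_wcomp :: "real \<Rightarrow> 'a measure \<Rightarrow> ('a \<Rightarrow> 'k::{real_normed_field,second_countable_topology}) \<Rightarrow> ('a \<Rightarrow> 'a) \<Rightarrow>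
    ('a \<Rightarrow> 'k) set \<Rightarrow> ('a \<Rightarrow> 'k) set"
  where "Lp_wcomp p M w f A = lp_rel p M `` (wcomp w f ` A)"

text \<open>The value at \<open>n = 0\<close> is immaterial, as only a limit inferior over \<open>n\<close> is ever taken.\<close>

definition iter_weight :: "('a \<Rightarrow> 'k::{real_normed_field,second_countable_topology}) \<Rightarrow> ('a \<Rightarrow> 'a) \<Rightarrow> nat \<Rightarrow> 'a \<Rightarrow> 'k"
  where "iter_weight w f n x = (\<Prod>i<n. w ((f ^^ i) x))"

definition iter_measure :: "real \<Rightarrow> 'a measure \<Rightarrow> ('a \<Rightarrow> 'k::{real_normed_field,second_countable_topology}) \<Rightarrow> ('a \<Rightarrow> 'a) \<Rightarrow>
    nat \<Rightarrow> 'a set \<Rightarrow> ennreal"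
  where "iter_measure p M w f n B = (\<integral>\<^sup>+x\<in>B. ennreal (norm (iter_weight w f n x) powr p) \<partial>M)"

definition liminf_null_sets :: "real \<Rightarrow> 'a measure \<Rightarrow> ('a \<Rightarrow> 'k::{real_normed_field,second_countable_topology}) \<Rightarrow>
    ('a \<Rightarrow> 'a) \<Rightarrow> 'a set set"
  where "liminf_null_sets p M w f =
    {B \<in> sets M. emeasure M B < \<infinity> \<and>
      liminf (\<lambda>n. iter_measure p M w f n ((f ^^ n) -` B \<inter> space M)) = 0}"

definition liminf_null_subspace :: "real \<Rightarrow> 'a measure \<Rightarrow> ('a \<Rightarrow> 'k::{real_normed_field,second_countable_topology}) \<Rightarrow>
    ('a \<Rightarrow> 'a) \<Rightarrow> ('a \<Rightarrow> 'k) set set"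
  where "liminf_null_subspace p M w f =
    Lp_closed_span p M ((\<lambda>B. indicator B) ` liminf_null_sets p M w f)"

text \<open>The operator respects almost everywhere equality, so that \<^const>\<open>Lp_wcomp\<close> is the map
  induced on classes.\<close>

lemma wcomp_nn_integral_le:
  fixes w :: "'a \<Rightarrow> 'k::{real_normed_field,second_countable_topology}"
  assumes W: "weighted_composition p M w f"
  obtains c :: real where "0 < c"
    "\<And>g. g \<in> borel_measurable M \<Longrightarrow>
      (\<integral>\<^sup>+x. ennreal (norm (w x) powr p) * g (f x) \<partial>M) \<le> ennreal c * (\<integral>\<^sup>+x. g x \<partial>M)"
proof -
  from W have w [measurable]: "w \<in> borel_measurable M" and f [measurable]: "f \<in> measurable M M"
    by (auto simp: weighted_composition_def)
  from W obtain c :: real where c: "0 < c"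
    "\<And>B. B \<in> sets M \<Longrightarrow> (\<integral>\<^sup>+x\<in>B. ennreal (norm (w x) powr p) \<partial>M) \<le> ennreal c * emeasure M (f ` B)"
    by (auto simp: weighted_composition_def)
  let ?D = "density M (\<lambda>x. ennreal (norm (w x) powr p))"
  let ?N = "distr ?D M f" and ?S = "scale_measure (ennreal c) M"
  have le: "emeasure ?N A \<le> emeasure ?S A" for A
  proof (cases "A \<in> sets M")
    case True
    have B: "f -` A \<inter> space M \<in> sets M" using True by measurable
    have "emeasure ?N A = (\<integral>\<^sup>+x\<in>f -` A \<inter> space M. ennreal (norm (w x) powr p) \<partial>M)"
      using True B by (simp add: emeasure_distr emeasure_density)
    also have "\<dots> \<le> ennreal c * emeasure M (f ` (f -` A \<inter> space M))" by (rule c(2)[OF B])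
    also have "\<dots> \<le> ennreal c * emeasure M A"
      using True by (intro mult_left_mono emeasure_mono) auto
    finally show ?thesis by simp
  next
    case False
    then show ?thesis by (simp add: emeasure_notin_sets)
  qed
  have "(\<integral>\<^sup>+x. ennreal (norm (w x) powr p) * g (f x) \<partial>M) \<le> ennreal c * (\<integral>\<^sup>+x. g x \<partial>M)"
    if g [measurable]: "g \<in> borel_measurable M" for g
  proof -
    have "(\<integral>\<^sup>+x. ennreal (norm (w x) powr p) * g (f x) \<partial>M) = (\<integral>\<^sup>+x. g x \<partial>?N)"
      by (subst nn_integral_distr) (auto simp: nn_integral_density)
    also have "\<dots> \<le> (\<integral>\<^sup>+x. g x \<partial>?S)"
      using le by (intro nn_integral_mono_measure) (auto simp: le_measure le_fun_def)
    also have "\<dots> = ennreal c * (\<integral>\<^sup>+x. g x \<partial>M)" by (simp add: nn_integral_scale_measure)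
    finally show ?thesis .
  qed
  with c(1) show ?thesis by (rule that)
qed

lemma wcomp_lp_fun:
  assumes W: "weighted_composition p M w f" and \<phi>: "\<phi> \<in> lp_fun p M"
  shows "wcomp w f \<phi> \<in> lp_fun p M"
proof -
  from W have [measurable]: "w \<in> borel_measurable M" "f \<in> measurable M M"
    by (auto simp: weighted_composition_def)
  from \<phi> have [measurable]: "\<phi> \<in> borel_measurable M" and
    i: "(\<integral>\<^sup>+x. ennreal (norm (\<phi> x) powr p) \<partial>M) < \<infinity>"
    by (auto simp: lp_fun_def integrable_iff_bounded)
  obtain c :: real where c: "\<And>g. g \<in> borel_measurable M \<Longrightarrow>
      (\<integral>\<^sup>+x. ennreal (norm (w x) powr p) * g (f x) \<partial>M) \<le> ennreal c * (\<integral>\<^sup>+x. g x \<partial>M)"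
    using wcomp_nn_integral_le[OF W] by blast
  have "(\<integral>\<^sup>+x. ennreal (norm (w x) powr p) * ennreal (norm (\<phi> (f x)) powr p) \<partial>M)
      \<le> ennreal c * (\<integral>\<^sup>+x. ennreal (norm (\<phi> x) powr p) \<partial>M)"
    by (rule c) measurable
  also have "\<dots> < \<infinity>" using i by (simp add: ennreal_mult_less_top)
  finally show ?thesis
    by (simp add: lp_fun_def wcomp_def integrable_iff_bounded norm_mult powr_mult ennreal_mult' mult.commute)
qed

lemma wcomp_cong_AE:
  assumes W: "weighted_composition p M w f"
    and "\<phi> \<in> borel_measurable M" "\<psi> \<in> borel_measurable M" "AE x in M. \<phi> x = \<psi> x"
  shows "AE x in M. wcomp w f \<phi> x = wcomp w f \<psi> x"
proof -
  from W have [measurable]: "w \<in> borel_measurable M" "f \<in> measurable M M"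
    by (auto simp: weighted_composition_def)
  define N where "N = {x \<in> space M. \<phi> x \<noteq> \<psi> x}"
  have N [measurable]: "N \<in> sets M" unfolding N_def using assms(2,3) by measurable
  have "emeasure M N = 0" using assms(4) N by (simp add: N_def AE_iff_measurable[OF _ refl])
  moreover obtain c :: real where "(\<integral>\<^sup>+x. ennreal (norm (w x) powr p) * indicator N (f x) \<partial>M)
      \<le> ennreal c * (\<integral>\<^sup>+x. indicator N x \<partial>M)"
    using wcomp_nn_integral_le[OF W] by (metis N borel_measurable_indicator)
  ultimately have "(\<integral>\<^sup>+x. ennreal (norm (w x) powr p) * indicator N (f x) \<partial>M) = 0"
    by simp
  then have "AE x in M. ennreal (norm (w x) powr p) * indicator N (f x) = 0"
    by (subst (asm) nn_integral_0_iff_AE) auto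
  with AE_space show ?thesis
  proof eventually_elim
    case (elim x)
    have "f x \<in> space M" using elim(1) measurable_space[OF \<open>f \<in> measurable M M\<close>] by blast
    with elim show ?case by (auto simp: N_def wcomp_def indicator_def split: if_splits)
  qed
qed

lemma Lp_wcomp_class:
  assumes W: "weighted_composition p M w f" and \<phi>: "\<phi> \<in> lp_fun p M"
  shows "Lp_wcomp p M w f (lp_class p M \<phi>) = lp_class p M (wcomp w f \<phi>)"
proof -
  have "lp_rel p M `` {wcomp w f \<psi>} = lp_rel p M `` {wcomp w f \<phi>}" if "\<psi> \<in> lp_class p M \<phi>" for \<psi>
  proof (rule sym, rule equiv_class_eq[OF equiv_lp_rel])
    from that have "\<psi> \<in> lp_fun p M" "AE x in M. \<phi> x = \<psi> x" by (auto simp: lp_class_def lp_rel_def)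
    with \<phi> show "(wcomp w f \<phi>, wcomp w f \<psi>) \<in> lp_rel p M"
      using wcomp_lp_fun[OF W] wcomp_cong_AE[OF W] by (auto simp: lp_rel_def lp_fun_def)
  qed
  moreover have "\<phi> \<in> lp_class p M \<phi>" using \<phi> by (simp add: lp_class_def lp_rel_def)
  ultimately show ?thesis unfolding Lp_wcomp_def lp_class_def by blast
qed

section \<open>Power-boundedness and Li-Yorke chaos\<close>

text \<open>Norm of the restriction of a linear map \<open>T\<close> to a subspace \<open>Z\<close>, for a space given by its norm
  function \<open>N\<close>; as in the library's \<^const>\<open>onorm\<close>, the zero vector contributes \<open>0 / 0 = 0\<close>.\<close>

definition restrict_onorm :: "('v \<Rightarrow> real) \<Rightarrow> 'v set \<Rightarrow> ('v \<Rightarrow> 'v) \<Rightarrow> ennreal"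
  where "restrict_onorm N Z T = (SUP z\<in>Z. ennreal (N (T z) / N z))"

definition power_bounded_in :: "('v \<Rightarrow> real) \<Rightarrow> ('v \<Rightarrow> 'v) \<Rightarrow> 'v set \<Rightarrow> bool"
  where "power_bounded_in N T Z \<longleftrightarrow>
    (\<exists>C::real. 0 < C \<and> (\<forall>n\<ge>1. restrict_onorm N Z (T ^^ n) \<le> ennreal C))"

text \<open>The limits are taken in \<^typ>\<open>ereal\<close>, since orbit distances may be unbounded.\<close>

definition li_yorke_chaotic :: "'v set \<Rightarrow> ('v \<Rightarrow> 'v \<Rightarrow> real) \<Rightarrow> ('v \<Rightarrow> 'v) \<Rightarrow> bool"
  where "li_yorke_chaotic M d g \<longleftrightarrow>
    (\<exists>S\<subseteq>M. uncountable S \<and>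
      (\<forall>x\<in>S. \<forall>y\<in>S. x \<noteq> y \<longrightarrow>
        liminf (\<lambda>n. ereal (d ((g ^^ n) x) ((g ^^ n) y))) = 0 \<and>
        limsup (\<lambda>n. ereal (d ((g ^^ n) x) ((g ^^ n) y))) > 0))"

end

theory Submission
  imports Defs
begin

text \<open>A function \<open>\<phi>\<close> whose orbit norms have limit inferior zero but do not tend to zero already gives
  chaos, since its scalar multiples form a scrambled set; conversely, the difference of two scrambled
  points is such a \<open>\<phi>\<close>. If the orbit norms of \<open>\<phi>\<close> have limit inferior zero, then so do those of the
  indicator of any measurable subset of \<open>{\<bar>\<phi>\<bar> \<ge> a}\<close>, \<open>a > 0\<close>, so simple approximation puts \<open>\<phi>\<close> in the
  closed subspace. The same applies to every iterate of \<open>\<phi>\<close>, and power-boundedness would then force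
  the orbit norms to zero.

  For the other direction, if no indicator of a generating set is itself such a \<open>\<phi>\<close>, then all orbits
  of vectors in the (dense) span tend to zero, and unboundedness of the powers provides humps that are
  summed up. As \<open>\<parallel>T\<^sup>n \<phi>\<parallel>\<^sup>p\<close> is additive and monotone in the nonnegative function \<open>\<bar>\<phi>\<bar>\<^sup>p\<close>, the humps are
  nonnegative functions that cannot cancel, and monotone convergence replaces the completeness of the
  space.\<close>

section \<open>Limits inferior and superior as statements about frequently small terms\<close>

lemma Liminf_le_iff_frequently:
  fixes C :: "'b :: {complete_linorder, dense_linorder}"
  shows "Liminf F X \<le> C \<longleftrightarrow> (\<forall>y>C. \<exists>\<^sub>F x in F. X x < y)"
proof
  assume L: "Liminf F X \<le> C"
  show "\<forall>y>C. \<exists>\<^sub>F x in F. X x < y"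
  proof (intro allI impI, unfold frequently_def, rule notI)
    fix y assume "C < y" and ev: "\<forall>\<^sub>F x in F. \<not> X x < y"
    have "y \<le> Liminf F X"
      by (rule Liminf_bounded) (use ev in \<open>simp add: not_less\<close>)
    with L \<open>C < y\<close> show False by simp
  qed
next
  assume R: "\<forall>y>C. \<exists>\<^sub>F x in F. X x < y"
  show "Liminf F X \<le> C"
  proof (rule ccontr)
    assume "\<not> Liminf F X \<le> C"
    then obtain y where "C < y" "y < Liminf F X" using dense by (auto simp: not_le)
    from less_LiminfD[OF this(2)] have "\<forall>\<^sub>F x in F. \<not> X x < y"
      by eventually_elim simp
    with R \<open>C < y\<close> show False by (auto simp: frequently_def)
  qed
qed

lemma liminf_ennreal_eq_0_iff:
  fixes X :: "nat \<Rightarrow> ennreal"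
  shows "liminf X = 0 \<longleftrightarrow> (\<forall>e>0. \<exists>\<^sub>F n in sequentially. X n < e)"
  using Liminf_le_iff_frequently[of sequentially X 0] by simp

lemma liminf_ereal_eq_0_iff:
  fixes a :: "nat \<Rightarrow> real"
  assumes a: "\<And>n. 0 \<le> a n"
  shows "liminf (\<lambda>n. ereal (a n)) = 0 \<longleftrightarrow> (\<forall>e>0. \<exists>\<^sub>F n in sequentially. a n < e)"
proof -
  have "0 \<le> liminf (\<lambda>n. ereal (a n))" by (rule Liminf_bounded) (simp add: a)
  then have "liminf (\<lambda>n. ereal (a n)) = 0 \<longleftrightarrow> liminf (\<lambda>n. ereal (a n)) \<le> 0" by auto
  also have "\<dots> \<longleftrightarrow> (\<forall>y>0. \<exists>\<^sub>F n in sequentially. ereal (a n) < y)"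
    by (rule Liminf_le_iff_frequently)
  also have "\<dots> \<longleftrightarrow> (\<forall>e>0. \<exists>\<^sub>F n in sequentially. a n < e)"
  proof (intro iffI allI impI)
    fix e :: real assume "\<forall>y>0. \<exists>\<^sub>F n in sequentially. ereal (a n) < y" "0 < e"
    then have "\<exists>\<^sub>F n in sequentially. ereal (a n) < ereal e" by (metis ereal_less(2))
    then show "\<exists>\<^sub>F n in sequentially. a n < e" by simp
  next
    fix y :: ereal assume R: "\<forall>e>0. \<exists>\<^sub>F n in sequentially. a n < e" and "0 < y"
    then show "\<exists>\<^sub>F n in sequentially. ereal (a n) < y"
      by (cases y) auto
  qed
  finally show ?thesis .
qed

lemma limsup_ereal_pos_iff:
  fixes a :: "nat \<Rightarrow> real"
  assumes a: "\<And>n. 0 \<le> a n"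
  shows "limsup (\<lambda>n. ereal (a n)) > 0 \<longleftrightarrow> \<not> a \<longlonglongrightarrow> 0"
proof -
  have 0: "0 \<le> liminf (\<lambda>n. ereal (a n))" by (rule Liminf_bounded) (simp add: a)
  have "limsup (\<lambda>n. ereal (a n)) \<le> 0 \<longleftrightarrow> (\<lambda>n. ereal (a n)) \<longlonglongrightarrow> 0"
  proof
    assume "limsup (\<lambda>n. ereal (a n)) \<le> 0"
    with 0 show "(\<lambda>n. ereal (a n)) \<longlonglongrightarrow> 0"
      using Liminf_le_Limsup[of sequentially "\<lambda>n. ereal (a n)"]
      by (intro Liminf_eq_Limsup) auto
  next
    assume "(\<lambda>n. ereal (a n)) \<longlonglongrightarrow> 0"
    from lim_imp_Limsup[OF _ this] show "limsup (\<lambda>n. ereal (a n)) \<le> 0" by simp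
  qed
  also have "\<dots> \<longleftrightarrow> a \<longlonglongrightarrow> 0" by (simp add: zero_ereal_def)
  finally show ?thesis by (simp add: not_le[symmetric])
qed

text \<open>The generating sets are described by extended \<open>p\<close>-th powers, chaos by real
  norms. The map \<open>t powr p\<close> is increasing on nonnegative reals with inverse
  \<open>t powr (1 / p)\<close>, so both notions of being frequently small agree.\<close>

lemma frequently_ennreal_powr_less_iff:
  fixes a :: "nat \<Rightarrow> real"
  assumes a: "\<And>n. 0 \<le> a n" and p: "0 < p"
  shows "(\<forall>e>0. \<exists>\<^sub>F n in sequentially. ennreal (a n powr p) < e)
     \<longleftrightarrow> (\<forall>e>0. \<exists>\<^sub>F n in sequentially. a n < e)"
proof (intro iffI allI impI)
  fix e :: real
  assume L: "\<forall>e>0. \<exists>\<^sub>F n in sequentially. ennreal (a n powr p) < e" and e: "0 < e"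
  have "\<exists>\<^sub>F n in sequentially. ennreal (a n powr p) < ennreal (e powr p)" using L e by simp
  then show "\<exists>\<^sub>F n in sequentially. a n < e"
    by (rule frequently_elim1)
      (use a p e in \<open>metis ennreal_less_iff powr_ge_zero powr_mono2 not_less less_eq_real_def\<close>)
next
  fix e :: ennreal
  assume R: "\<forall>e>0. \<exists>\<^sub>F n in sequentially. a n < e" and e: "0 < e"
  show "\<exists>\<^sub>F n in sequentially. ennreal (a n powr p) < e"
  proof (cases e)
    case (real r)
    with e have r: "0 < r" by (auto simp: less_le)
    then have "\<exists>\<^sub>F n in sequentially. a n < r powr (1 / p)" using R by simp
    then show ?thesis
    proof (rule frequently_elim1)
      fix n assume "a n < r powr (1 / p)"
      then have "a n powr p < (r powr (1 / p)) powr p" using a p by (intro powr_less_mono2) auto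
      then show "ennreal (a n powr p) < e" using p r real by (simp add: powr_powr ennreal_less_iff)
    qed
  \<comment> \<open>The remaining case is an infinite \<open>e\<close>, which exceeds every
    term.\<close>
  qed (simp add: frequently_const)
qed

section \<open>Iterates of the operator and their action on nonnegative functions\<close>

lemma funpow_measurable [measurable (raw)]:
  assumes "f \<in> measurable M M"
  shows "(f ^^ n) \<in> measurable M M"
  by (induction n) (auto simp: comp_def intro: measurable_compose[OF _ assms])

lemma iter_weight_0: "iter_weight w f 0 x = 1"
  by (simp add: iter_weight_def)

lemma iter_weight_Suc: "iter_weight w f (Suc n) x = w x * iter_weight w f n (f x)"
  unfolding iter_weight_def prod.lessThan_Suc_shift by (simp add: funpow_swap1)

lemma wcomp_funpow: "(wcomp w f ^^ n) \<phi> = (\<lambda>x. iter_weight w f n x * \<phi> ((f ^^ n) x))"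
  by (induction n) (auto simp: fun_eq_iff wcomp_def iter_weight_0 iter_weight_Suc funpow_swap1 mult_ac)

text \<open>The scalar type stays generic, so that the real and the complex case are two instances
  of one argument.\<close>

locale wcomp_operator =
  fixes p :: real and M :: "'a measure" and f :: "'a \<Rightarrow> 'a"
    and w :: "'a \<Rightarrow> 'k :: {real_normed_field, second_countable_topology}"
  assumes p: "1 \<le> p" and W: "weighted_composition p M w f"
begin

abbreviation T :: "nat \<Rightarrow> ('a \<Rightarrow> 'k) \<Rightarrow> 'a \<Rightarrow> 'k" where "T n \<equiv> wcomp w f ^^ n"

abbreviation pow :: "('a \<Rightarrow> 'k) \<Rightarrow> 'a \<Rightarrow> ennreal" where "pow \<phi> \<equiv> \<lambda>x. ennreal (norm (\<phi> x) powr p)"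

text \<open>\<open>J n \<bar>\<phi>\<bar>\<^sup>p = \<parallel>T\<^sup>n \<phi>\<parallel>\<^sup>p\<close>; unlike the norm, \<open>J n\<close> is additive.\<close>

definition J :: "nat \<Rightarrow> ('a \<Rightarrow> ennreal) \<Rightarrow> ennreal" where
  "J n u = (\<integral>\<^sup>+x. ennreal (norm (iter_weight w f n x) powr p) * u ((f ^^ n) x) \<partial>M)"

lemma w_measurable [measurable]: "w \<in> borel_measurable M"
  and f_measurable [measurable]: "f \<in> measurable M M"
  using W by (auto simp: weighted_composition_def)

lemma iter_weight_measurable [measurable]: "iter_weight w f n \<in> borel_measurable M"
proof (induction n)
  case 0
  then show ?case by (simp add: iter_weight_0[abs_def])
next
  case (Suc n)
  note [measurable] = Suc
  show ?case unfolding iter_weight_Suc[abs_def] by measurable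
qed

lemma lp_fun_measurable: "\<phi> \<in> lp_fun p M \<Longrightarrow> \<phi> \<in> borel_measurable M"
  by (simp add: lp_fun_def)

lemma T_lp_fun: "\<phi> \<in> lp_fun p M \<Longrightarrow> T n \<phi> \<in> lp_fun p M"
  by (induction n) (auto intro: wcomp_lp_fun[OF W])

lemma Lp_wcomp_funpow_class:
  "\<phi> \<in> lp_fun p M \<Longrightarrow> (Lp_wcomp p M w f ^^ n) (lp_class p M \<phi>) = lp_class p M (T n \<phi>)"
  by (induction n) (auto simp: Lp_wcomp_class[OF W T_lp_fun])

lemma nn_integral_pow: "\<phi> \<in> lp_fun p M \<Longrightarrow> (\<integral>\<^sup>+x. pow \<phi> x \<partial>M) = ennreal (lp_norm p M \<phi> powr p)"
  unfolding lp_norm_powr[OF p] by (intro nn_integral_eq_integral) (auto simp: lp_fun_def)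

lemma J_pow: "\<phi> \<in> lp_fun p M \<Longrightarrow> J n (pow \<phi>) = ennreal (lp_norm p M (T n \<phi>) powr p)"
  by (subst nn_integral_pow[OF T_lp_fun, symmetric])
    (auto simp: J_def wcomp_funpow norm_mult powr_mult ennreal_mult)

lemma J_0: "J 0 u = (\<integral>\<^sup>+x. u x \<partial>M)"
  by (simp add: J_def iter_weight_0)

lemma J_mono: "(\<And>x. u x \<le> v x) \<Longrightarrow> J n u \<le> J n v"
  unfolding J_def by (intro nn_integral_mono mult_left_mono) auto

lemma J_add:
  assumes [measurable]: "u \<in> borel_measurable M" "v \<in> borel_measurable M"
  shows "J n (\<lambda>x. u x + v x) = J n u + J n v"
  unfolding J_def by (simp add: distrib_left nn_integral_add)

lemma J_cmult:
  assumes [measurable]: "u \<in> borel_measurable M"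
  shows "J n (\<lambda>x. k * u x) = k * J n u"
  unfolding J_def by (subst nn_integral_cmult[symmetric]) (auto simp: mult_ac)

lemma J_sum:
  assumes "\<And>i. i \<in> I \<Longrightarrow> u i \<in> borel_measurable M"
  shows "J n (\<lambda>x. \<Sum>i\<in>I. u i x) = (\<Sum>i\<in>I. J n (u i))"
proof (cases "finite I")
  case True
  then show ?thesis using assms
    by (induction I) (auto simp: J_add borel_measurable_sum, simp add: J_def)
qed (simp add: J_def)

lemma J_SUP:
  assumes "incseq u" and [measurable]: "\<And>i. u i \<in> borel_measurable M"
  shows "J n (\<lambda>x. SUP i. u i x) = (SUP i. J n (u i))"
  unfolding J_def SUP_mult_left_ennreal
  by (rule nn_integral_monotone_convergence_SUP)
    (use assms(1) in \<open>auto simp: incseq_def le_fun_def intro!: mult_left_mono\<close>)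

text \<open>Peeling off the innermost factor of the weight turns \<open>J (Suc n)\<close> into a
  one-step integral, to which the boundedness estimate of the operator applies; iterate.\<close>

lemma J_bound:
  obtains c :: real where "1 \<le> c"
    "\<And>n u. u \<in> borel_measurable M \<Longrightarrow> J n u \<le> ennreal (c ^ n) * (\<integral>\<^sup>+x. u x \<partial>M)"
proof -
  obtain c0 :: real where c0: "0 < c0" "\<And>g. g \<in> borel_measurable M \<Longrightarrow>
      (\<integral>\<^sup>+x. ennreal (norm (w x) powr p) * g (f x) \<partial>M) \<le> ennreal c0 * (\<integral>\<^sup>+x. g x \<partial>M)"
    using wcomp_nn_integral_le[OF W] by blast
  \<comment> \<open>Enlarging the constant to at least 1 makes \<open>c ^ n\<close> increasing in
    \<open>n\<close>, which the gliding hump relies on.\<close>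
  define c where "c = max 1 c0"
  have c: "1 \<le> c" by (simp add: c_def)
  have "J n u \<le> ennreal (c ^ n) * (\<integral>\<^sup>+x. u x \<partial>M)" if [measurable]: "u \<in> borel_measurable M" for n u
  proof (induction n)
    case (Suc n)
    have "J (Suc n) u = (\<integral>\<^sup>+x. ennreal (norm (w x) powr p) *
        (ennreal (norm (iter_weight w f n (f x)) powr p) * u ((f ^^ n) (f x))) \<partial>M)"
      by (simp add: J_def iter_weight_Suc norm_mult powr_mult ennreal_mult mult_ac funpow_swap1)
    also have "\<dots> \<le> ennreal c0 * J n u"
      unfolding J_def by (rule c0(2)) measurable
    also have "\<dots> \<le> ennreal c * (ennreal (c ^ n) * (\<integral>\<^sup>+x. u x \<partial>M))"
      using Suc by (intro mult_mono) (auto simp: c_def intro: ennreal_leI)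
    finally show ?case using c by (simp add: ennreal_mult mult.assoc)
  qed (simp add: J_0)
  with c show ?thesis by (rule that)
qed

lemma lp_norm_T_bound:
  obtains L :: "nat \<Rightarrow> real" where
    "\<And>n. 0 \<le> L n" "\<And>n \<phi>. \<phi> \<in> lp_fun p M \<Longrightarrow> lp_norm p M (T n \<phi>) \<le> L n * lp_norm p M \<phi>"
proof -
  obtain c where c: "1 \<le> c" and J:
    "\<And>n u. u \<in> borel_measurable M \<Longrightarrow> J n u \<le> ennreal (c ^ n) * (\<integral>\<^sup>+x. u x \<partial>M)"
    using J_bound by blast
  have "lp_norm p M (T n \<phi>) \<le> (c ^ n) powr (1 / p) * lp_norm p M \<phi>" if \<phi>: "\<phi> \<in> lp_fun p M" for n \<phi>
  proof -
    have [measurable]: "\<phi> \<in> borel_measurable M" using \<phi> by (rule lp_fun_measurable)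
    have "ennreal (lp_norm p M (T n \<phi>) powr p) \<le> ennreal (c ^ n) * ennreal (lp_norm p M \<phi> powr p)"
      using J[of "pow \<phi>" n] by (simp add: J_pow[OF \<phi>] nn_integral_pow[OF \<phi>])
    then have "lp_norm p M (T n \<phi>) powr p \<le> c ^ n * lp_norm p M \<phi> powr p"
      using c by (simp add: ennreal_mult[symmetric])
    then have "(lp_norm p M (T n \<phi>) powr p) powr (1 / p) \<le> (c ^ n * lp_norm p M \<phi> powr p) powr (1 / p)"
      using p by (intro powr_mono2) auto
    then show ?thesis using p c by (simp add: powr_powr powr_mult lp_norm_nonneg)
  qed
  then show ?thesis by (intro that[of "\<lambda>n. (c ^ n) powr (1 / p)"]) auto
qed

text \<open>Turns the condition on generating sets into one on the orbit of an indicator function.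
  The intersection with \<open>space M\<close> is harmless because the integral only sees points of
  \<open>space M\<close>.\<close>

lemma iter_measure_preimage:
  "iter_measure p M w f n ((f ^^ n) -` B \<inter> space M) = J n (indicator B)"
  unfolding iter_measure_def J_def
  by (intro nn_integral_cong) (auto simp: indicator_def)

lemma liminf_null_sets_iff:
  "B \<in> liminf_null_sets p M w f \<longleftrightarrow>
    B \<in> sets M \<and> emeasure M B < \<infinity> \<and> (\<forall>e>0. \<exists>\<^sub>F n in sequentially. J n (indicator B) < e)"
  by (simp add: liminf_null_sets_def iter_measure_preimage liminf_ennreal_eq_0_iff)

lemma frequently_J_pow_iff:
  assumes "\<phi> \<in> lp_fun p M"
  shows "(\<forall>e>0. \<exists>\<^sub>F n in sequentially. J n (pow \<phi>) < e) \<longleftrightarrow>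
    (\<forall>e>0. \<exists>\<^sub>F n in sequentially. lp_norm p M (T n \<phi>) < e)"
  unfolding J_pow[OF assms] using p by (intro frequently_ennreal_powr_less_iff) (auto simp: lp_norm_nonneg)

lemma T_diff: "T n (\<lambda>x. \<phi> x - \<psi> x) = (\<lambda>x. T n \<phi> x - T n \<psi> x)"
  by (simp add: wcomp_funpow right_diff_distrib)

lemma T_scale: "T n (\<lambda>x. k * \<phi> x) = (\<lambda>x. k * T n \<phi> x)"
  by (simp add: wcomp_funpow mult_ac)

lemma lp_norm_scale: "lp_norm p M (\<lambda>x. k * \<phi> x) = norm k * lp_norm p M \<phi>" for \<phi> :: "'a \<Rightarrow> 'k"
  using p by (simp add: lp_norm_def norm_mult powr_mult powr_powr)

section \<open>Scrambled sets from a single vector\<close>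

lemma semi_irregular_imp_chaotic:
  assumes \<phi>: "\<phi> \<in> lp_fun p M"
    and small: "\<And>e. 0 < e \<Longrightarrow> \<exists>\<^sub>F n in sequentially. lp_norm p M (T n \<phi>) < e"
    and nlim: "\<not> (\<lambda>n. lp_norm p M (T n \<phi>)) \<longlonglongrightarrow> 0"
  shows "li_yorke_chaotic (Lp p M) (Lp_dist p M) (Lp_wcomp p M w f)"
proof -
  define F where "F t = lp_class p M (\<lambda>x. of_real t * \<phi> x)" for t :: real
  have s: "(\<lambda>x. of_real t * \<phi> x) \<in> lp_fun p M" for t by (rule lp_fun_scale[OF \<phi>])
  have d: "Lp_dist p M ((Lp_wcomp p M w f ^^ n) (F t)) ((Lp_wcomp p M w f ^^ n) (F t'))
      = \<bar>t - t'\<bar> * lp_norm p M (T n \<phi>)" for n t t'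
  proof -
    have "Lp_dist p M ((Lp_wcomp p M w f ^^ n) (F t)) ((Lp_wcomp p M w f ^^ n) (F t')) =
        lp_norm p M (\<lambda>x. of_real (t - t') * T n \<phi> x)"
      by (simp add: F_def Lp_wcomp_funpow_class[OF s] Lp_dist_class T_lp_fun s T_scale lp_fun_scale \<phi>
          left_diff_distrib)
    then show ?thesis by (simp only: lp_norm_scale norm_of_real)
  qed
  have lim: "liminf (\<lambda>n. ereal (\<bar>t - t'\<bar> * lp_norm p M (T n \<phi>))) = 0 \<and>
      limsup (\<lambda>n. ereal (\<bar>t - t'\<bar> * lp_norm p M (T n \<phi>))) > 0" if "t \<noteq> t'" for t t' :: real
  proof (subst liminf_ereal_eq_0_iff limsup_ereal_pos_iff, simp add: lp_norm_nonneg)+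
    have "\<exists>\<^sub>F n in sequentially. \<bar>t - t'\<bar> * lp_norm p M (T n \<phi>) < e" if "0 < e" for e
      using small[of "e / \<bar>t - t'\<bar>"] that \<open>t \<noteq> t'\<close> by (simp add: field_simps)
    moreover have "\<not> (\<lambda>n. \<bar>t - t'\<bar> * lp_norm p M (T n \<phi>)) \<longlonglongrightarrow> 0"
      using nlim that by (subst tendsto_mult_left_iff[where c = "\<bar>t - t'\<bar>" and l = 0, simplified]) auto
    ultimately show "(\<forall>e>0. \<exists>\<^sub>F n in sequentially. \<bar>t - t'\<bar> * lp_norm p M (T n \<phi>) < e) \<and>
      \<not> (\<lambda>n. \<bar>t - t'\<bar> * lp_norm p M (T n \<phi>)) \<longlonglongrightarrow> 0" by blast
  qed
  \<comment> \<open>Two parameters with the same class would have orbit distance constantly zero,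
    against the positive limit superior.\<close>
  have "inj F"
  proof (rule injI, rule ccontr)
    fix t t' assume "F t = F t'" "t \<noteq> t'"
    with d[of _ t t] d[of _ t t'] have "\<bar>t - t'\<bar> * lp_norm p M (T n \<phi>) = 0" for n by simp
    with lim[OF \<open>t \<noteq> t'\<close>] show False by (simp add: zero_ereal_def[symmetric] Limsup_const)
  qed
  then have "uncountable (range F)"
    using uncountable_UNIV_real countable_image_inj_on by blast
  moreover have "range F \<subseteq> Lp p M" by (auto simp: F_def intro!: lp_class_in_Lp s)
  moreover have "\<forall>A\<in>range F. \<forall>B\<in>range F. A \<noteq> B \<longrightarrow>
      liminf (\<lambda>n. ereal (Lp_dist p M ((Lp_wcomp p M w f ^^ n) A) ((Lp_wcomp p M w f ^^ n) B))) = 0 \<and>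
      limsup (\<lambda>n. ereal (Lp_dist p M ((Lp_wcomp p M w f ^^ n) A) ((Lp_wcomp p M w f ^^ n) B))) > 0"
    unfolding ball_simps d using lim by metis
  ultimately show ?thesis unfolding li_yorke_chaotic_def by blast
qed

section \<open>The span of the generators and its closure\<close>

text \<open>Consists of functions, not classes, and repeats the set inside
  \<open>Lp_closed_span\<close> verbatim so that it can be folded there.\<close>

definition span_sets :: "('a \<Rightarrow> 'k) set" where
  "span_sets = {(\<lambda>x. \<Sum>\<phi>\<in>F. c \<phi> * \<phi> x) | F c. finite F \<and> F \<subseteq> (\<lambda>B. indicator B) ` liminf_null_sets p M w f}"

text \<open>Combinations in \<open>span_sets\<close> are indexed by the generators themselves,
  simple functions by their values. Indices with the same indicator are merged by adding their
  coefficients.\<close>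

lemma span_setsI:
  assumes "finite Y" "\<And>y. y \<in> Y \<Longrightarrow> B y \<in> liminf_null_sets p M w f"
  shows "(\<lambda>x. \<Sum>y\<in>Y. k y * indicator (B y) x) \<in> span_sets"
proof -
  let ?i = "\<lambda>y. indicator (B y) :: 'a \<Rightarrow> 'k"
  have "(\<Sum>y\<in>Y. k y * ?i y x) = (\<Sum>\<phi>\<in>?i ` Y. sum k {y \<in> Y. ?i y = \<phi>} * \<phi> x)" for x
    by (subst sum.image_gen[OF assms(1), where g = ?i]) (auto simp: sum_distrib_right intro!: sum.cong)
  then show ?thesis
    unfolding span_sets_def using assms
    by (intro CollectI exI[of _ "?i ` Y"] exI[of _ "\<lambda>\<phi>. sum k {y \<in> Y. ?i y = \<phi>}"]) auto
qed

lemma in_subspace_iff: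
  "A \<in> liminf_null_subspace p M w f \<longleftrightarrow>
    A \<in> Lp p M \<and> (\<forall>r>0. \<exists>g\<in>span_sets. lp_class p M g \<in> Lp p M \<and> Lp_dist p M A (lp_class p M g) < r)"
  unfolding liminf_null_subspace_def Lp_closed_span_def span_sets_def[symmetric]
    Metric_space.metric_closure_of[OF Metric_space_Lp[OF p]]
  by (auto simp: Metric_space.in_mball[OF Metric_space_Lp[OF p]])

lemma lp_fun_iff: "\<phi> \<in> lp_fun p M \<longleftrightarrow> \<phi> \<in> borel_measurable M \<and> (\<integral>\<^sup>+x. pow \<phi> x \<partial>M) < \<infinity>"
  for \<phi> :: "'a \<Rightarrow> 'k"
  by (auto simp: lp_fun_def integrable_iff_bounded)

text \<open>Chebyshev's inequality: the indicator of \<open>B\<close> is at most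
  \<open>1 / a powr p\<close> times \<open>pow \<phi>\<close>, and every \<open>J n\<close> is
  monotone and homogeneous.\<close>

lemma level_set_liminf_null:
  assumes \<phi>: "\<phi> \<in> lp_fun p M" and small: "\<forall>e>0. \<exists>\<^sub>F n in sequentially. J n (pow \<phi>) < e"
    and B: "B \<in> sets M" and a: "0 < a" and le: "\<And>x. x \<in> B \<Longrightarrow> a \<le> norm (\<phi> x)"
  shows "B \<in> liminf_null_sets p M w f"
proof -
  define k where "k = ennreal (1 / a powr p)"
  have k: "0 < k" "k < \<infinity>" using a by (auto simp: k_def)
  have [measurable]: "\<phi> \<in> borel_measurable M" using \<phi> by (rule lp_fun_measurable)
  have ind: "indicator B x \<le> k * pow \<phi> x" for x
  proof (cases "x \<in> B")
    case True
    then have "a powr p \<le> norm (\<phi> x) powr p" using le a p by (intro powr_mono2) auto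
    then have "ennreal 1 \<le> ennreal (1 / a powr p * norm (\<phi> x) powr p)"
      using a by (intro ennreal_leI) (simp add: field_simps)
    also have "\<dots> = k * pow \<phi> x" unfolding k_def by (rule ennreal_mult) auto
    finally show ?thesis using True by simp
  qed simp
  have J: "J n (indicator B) \<le> k * J n (pow \<phi>)" for n
    using J_mono[of "indicator B" "\<lambda>x. k * pow \<phi> x" n, OF ind] by (simp add: J_cmult)
  \<comment> \<open>Time 0 of the same estimate bounds the measure of \<open>B\<close>.\<close>
  have "emeasure M B = J 0 (indicator B)" using B by (simp add: J_0)
  also have "\<dots> \<le> k * (\<integral>\<^sup>+x. pow \<phi> x \<partial>M)" using J[of 0] by (simp add: J_0)
  also have "\<dots> < \<infinity>" using k \<phi> by (simp add: lp_fun_iff ennreal_mult_less_top)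
  finally have "emeasure M B < \<infinity>" .
  moreover have "\<exists>\<^sub>F n in sequentially. J n (indicator B) < e" if "0 < e" for e
  proof -
    have "0 < e / k" using that k by (simp add: ennreal_zero_less_divide)
    with small have "\<exists>\<^sub>F n in sequentially. J n (pow \<phi>) < e / k" by blast
    then show ?thesis
    proof (rule frequently_elim1)
      fix n assume "J n (pow \<phi>) < e / k"
      then have "k * J n (pow \<phi>) < k * (e / k)"
        using k by (intro ennreal_mult_strict_left_mono) auto
      also have "\<dots> = e"
        by (subst ennreal_times_divide, subst mult.commute, rule ennreal_mult_divide_eq) (use k in auto)
      finally have "k * J n (pow \<phi>) < e" .
      with J[of n] show "J n (indicator B) < e" by (rule le_less_trans)
    qed
  qed
  ultimately show ?thesis using B by (simp add: liminf_null_sets_iff)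
qed

text \<open>Approximate \<open>\<phi>\<close> by simple functions of modulus at most twice that of
  \<open>\<phi>\<close>. Their level set at \<open>y\<close> then lies where the modulus of
  \<open>\<phi>\<close> is at least \<open>norm y / 2\<close>, so it is a generating set if
  \<open>y\<close> is nonzero; dominated convergence gives convergence in norm.\<close>

lemma class_in_subspace:
  assumes \<phi>: "\<phi> \<in> lp_fun p M"
    and small: "\<And>e. 0 < e \<Longrightarrow> \<exists>\<^sub>F n in sequentially. lp_norm p M (T n \<phi>) < e"
  shows "lp_class p M \<phi> \<in> liminf_null_subspace p M w f"
proof -
  have J: "\<forall>e>0. \<exists>\<^sub>F n in sequentially. J n (pow \<phi>) < e"
    using small by (simp add: frequently_J_pow_iff[OF \<phi>])
  have [measurable]: "\<phi> \<in> borel_measurable M" using \<phi> by (rule lp_fun_measurable)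
  obtain s where "(\<forall>i. simple_function M (s i)) \<and> (\<forall>x\<in>space M. (\<lambda>i. s i x) \<longlonglongrightarrow> \<phi> x) \<and>
      (\<forall>i. \<forall>x\<in>space M. dist (s i x) 0 \<le> 2 * dist (\<phi> x) 0)"
    using borel_measurable_implies_sequence_metric[of \<phi> M 0] by auto
  then have s: "\<And>i. simple_function M (s i)"
    "\<And>x. x \<in> space M \<Longrightarrow> (\<lambda>i. s i x) \<longlonglongrightarrow> \<phi> x"
    "\<And>i x. x \<in> space M \<Longrightarrow> norm (s i x) \<le> 2 * norm (\<phi> x)"
    by simp_all
  define B where "B i y = s i -` {y} \<inter> space M" for i y
  \<comment> \<open>The value 0 adds nothing to the sum, and its level set may have infinite
    measure.\<close>
  define Y where "Y i = s i ` space M - {0}" for i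
  define g where "g i = (\<lambda>x. \<Sum>y\<in>Y i. y * indicator (B i y) x :: 'k)" for i
  have Y: "finite (Y i)" for i
    using s(1)[of i] by (simp add: Y_def simple_function_def)
  have B: "B i y \<in> sets M" for i y unfolding B_def by (rule simple_functionD(2)[OF s(1)])
  have "g i \<in> span_sets" for i
    unfolding g_def
  proof (rule span_setsI[OF Y])
    fix y assume "y \<in> Y i"
    then have "0 < norm y / 2" by (simp add: Y_def)
    from \<phi> J B this show "B i y \<in> liminf_null_sets p M w f"
    proof (rule level_set_liminf_null)
      fix x assume "x \<in> B i y"
      then show "norm y / 2 \<le> norm (\<phi> x)" using s(3)[of x i] by (auto simp: B_def)
    qed
  qed
  have g_eq: "g i x = s i x" if "x \<in> space M" for i x
  proof -
    have "g i x = (\<Sum>y\<in>Y i. if y = s i x then y else 0)"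
      unfolding g_def using that by (intro sum.cong) (auto simp: B_def)
    also have "\<dots> = s i x" using Y that by (auto simp: Y_def)
    finally show ?thesis .
  qed
  have gm [measurable]: "g i \<in> borel_measurable M" for i
    using borel_measurable_simple_function[OF s(1)[of i]] g_eq by (simp cong: measurable_cong)
  have bound: "norm (g i x - \<phi> x) powr p \<le> 3 powr p * norm (\<phi> x) powr p" if "x \<in> space M" for i x
  proof -
    have "norm (g i x - \<phi> x) \<le> norm (g i x) + norm (\<phi> x)" by (rule norm_triangle_ineq4)
    also have "\<dots> \<le> 3 * norm (\<phi> x)" using s(3)[OF that, of i] by (simp add: g_eq that)
    finally have "norm (g i x - \<phi> x) powr p \<le> (3 * norm (\<phi> x)) powr p"
      using p by (intro powr_mono2) auto
    then show ?thesis by (simp add: powr_mult)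
  qed
  have "g i \<in> lp_fun p M" for i
  proof -
    have "integrable M (\<lambda>x. norm (g i x - \<phi> x) powr p)"
    proof (rule Bochner_Integration.integrable_bound)
      show "integrable M (\<lambda>x. 3 powr p * norm (\<phi> x) powr p)" using \<phi> by (simp add: lp_fun_def)
      show "AE x in M. norm (norm (g i x - \<phi> x) powr p) \<le> norm (3 powr p * norm (\<phi> x) powr p)"
        using bound by (intro AE_I2) simp
    qed measurable
    then have "(\<lambda>x. g i x - \<phi> x) \<in> lp_fun p M" by (simp add: lp_fun_def)
    from lp_fun_add[OF p this \<phi>] show ?thesis by simp
  qed
  have "(\<lambda>i. \<integral>x. norm (g i x - \<phi> x) powr p \<partial>M) \<longlonglongrightarrow> (\<integral>x. 0 \<partial>M)"
  proof (rule integral_dominated_convergence[where w = "\<lambda>x. 3 powr p * norm (\<phi> x) powr p"])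
    show "AE x in M. (\<lambda>i. norm (g i x - \<phi> x) powr p) \<longlonglongrightarrow> 0"
    proof (rule AE_I2)
      fix x assume x: "x \<in> space M"
      have "(\<lambda>i. norm (g i x - \<phi> x)) \<longlonglongrightarrow> 0"
        using s(2)[OF x] by (simp add: g_eq x LIM_zero tendsto_norm_zero)
      then show "(\<lambda>i. norm (g i x - \<phi> x) powr p) \<longlonglongrightarrow> 0"
        using p by (intro tendsto_zero_powrI[where b = p]) auto
    qed
  qed (use \<phi> bound in \<open>auto simp: lp_fun_def\<close>)
  then have "(\<lambda>i. lp_norm p M (\<lambda>x. g i x - \<phi> x)) \<longlonglongrightarrow> 0"
    unfolding lp_norm_def using p by (intro tendsto_zero_powrI[where b = "1 / p"]) auto
  then have "(\<lambda>i. Lp_dist p M (lp_class p M \<phi>) (lp_class p M (g i))) \<longlonglongrightarrow> 0"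
    using \<open>\<And>i. g i \<in> lp_fun p M\<close> \<phi> by (simp add: Lp_dist_class lp_norm_def norm_minus_commute)
  then have "\<exists>i. Lp_dist p M (lp_class p M \<phi>) (lp_class p M (g i)) < r" if "0 < r" for r
    using order_tendstoD(2)[OF _ that] eventually_happens'[OF sequentially_bot] by blast
  then show ?thesis
    unfolding in_subspace_iff
    using \<open>\<And>i. g i \<in> lp_fun p M\<close> \<open>\<And>i. g i \<in> span_sets\<close> \<phi> by (blast intro: lp_class_in_Lp)
qed

section \<open>Power-boundedness excludes chaos\<close>

lemma Lp_norm_wcomp_funpow_class:
  "\<phi> \<in> lp_fun p M \<Longrightarrow> Lp_norm p M ((Lp_wcomp p M w f ^^ n) (lp_class p M \<phi>)) = lp_norm p M (T n \<phi>)"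
  by (simp add: Lp_wcomp_funpow_class Lp_norm_class T_lp_fun)

lemma chaotic_imp_not_power_bounded:
  assumes chaotic: "li_yorke_chaotic (Lp p M) (Lp_dist p M) (Lp_wcomp p M w f)"
  shows "\<not> power_bounded_in (Lp_norm p M) (Lp_wcomp p M w f) (liminf_null_subspace p M w f)"
proof
  assume "power_bounded_in (Lp_norm p M) (Lp_wcomp p M w f) (liminf_null_subspace p M w f)"
  then obtain C :: real where C: "0 < C"
    and onorm: "\<And>n. 1 \<le> n \<Longrightarrow>
      restrict_onorm (Lp_norm p M) (liminf_null_subspace p M w f) (Lp_wcomp p M w f ^^ n) \<le> ennreal C"
    unfolding power_bounded_in_def by blast
  have pb: "Lp_norm p M ((Lp_wcomp p M w f ^^ n) z) / Lp_norm p M z \<le> C"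
    if "1 \<le> n" "z \<in> liminf_null_subspace p M w f" for n z
  proof -
    have "ennreal (Lp_norm p M ((Lp_wcomp p M w f ^^ n) z) / Lp_norm p M z) \<le> ennreal C"
      using onorm[OF that(1)] that(2) unfolding restrict_onorm_def by (auto simp: SUP_le_iff)
    then show ?thesis using C by (simp add: ennreal_le_iff)
  qed
  from chaotic obtain S where S: "S \<subseteq> Lp p M" "uncountable S" and LY: "\<forall>A\<in>S. \<forall>B\<in>S. A \<noteq> B \<longrightarrow>
        liminf (\<lambda>n. ereal (Lp_dist p M ((Lp_wcomp p M w f ^^ n) A) ((Lp_wcomp p M w f ^^ n) B))) = 0 \<and>
        limsup (\<lambda>n. ereal (Lp_dist p M ((Lp_wcomp p M w f ^^ n) A) ((Lp_wcomp p M w f ^^ n) B))) > 0"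
    unfolding li_yorke_chaotic_def by (elim exE conjE)
  have "infinite S" using S(2) countable_finite by blast
  then obtain A where A: "A \<in> S" by fastforce
  from \<open>infinite S\<close> have "infinite (S - {A})" by simp
  then obtain B where "B \<in> S - {A}" using infinite_imp_nonempty by blast
  with A have AB: "A \<in> S" "B \<in> S" "A \<noteq> B" by auto
  define \<phi> where "\<phi> = (\<lambda>x. lp_rep A x - lp_rep B x)"
  have r: "lp_rep A \<in> lp_fun p M" "lp_class p M (lp_rep A) = A"
    "lp_rep B \<in> lp_fun p M" "lp_class p M (lp_rep B) = B"
    using AB S(1) lp_rep by blast+
  have \<phi>: "\<phi> \<in> lp_fun p M" unfolding \<phi>_def by (rule lp_fun_diff[OF p r(1) r(3)])
  have d: "Lp_dist p M ((Lp_wcomp p M w f ^^ n) A) ((Lp_wcomp p M w f ^^ n) B) = lp_norm p M (T n \<phi>)" for n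
    using Lp_wcomp_funpow_class[OF r(1), of n] Lp_wcomp_funpow_class[OF r(3), of n]
    by (simp add: r Lp_dist_class T_lp_fun T_diff \<phi>_def)
  from LY[rule_format, OF AB] have small: "\<And>e. 0 < e \<Longrightarrow> \<exists>\<^sub>F n in sequentially. lp_norm p M (T n \<phi>) < e"
    and nlim: "\<not> (\<lambda>n. lp_norm p M (T n \<phi>)) \<longlonglongrightarrow> 0"
    by (auto simp: d liminf_ereal_eq_0_iff limsup_ereal_pos_iff lp_norm_nonneg)
  have le: "lp_norm p M (T (n + m) \<phi>) \<le> C * lp_norm p M (T m \<phi>)" if "1 \<le> n" for n m
  proof -
    have Tm: "T m \<phi> \<in> lp_fun p M" by (rule T_lp_fun[OF \<phi>])
    \<comment> \<open>The orbit of \<open>T m \<phi>\<close> is a tail of the orbit of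
      \<open>\<phi>\<close>, so \<open>class_in_subspace\<close> applies to every iterate.\<close>
    have "\<exists>\<^sub>F k in sequentially. lp_norm p M (T k (T m \<phi>)) < e" if e: "0 < e" for e
    proof -
      have "\<forall>N. \<exists>k\<ge>N. lp_norm p M (T k \<phi>) < e"
        using small[OF e] by (simp add: frequently_sequentially)
      then have "\<exists>k\<ge>N. lp_norm p M (T (k + m) \<phi>) < e" for N
      proof -
        obtain k where "N + m \<le> k" "lp_norm p M (T k \<phi>) < e"
          using \<open>\<forall>N. \<exists>k\<ge>N. lp_norm p M (T k \<phi>) < e\<close> by blast
        then show ?thesis by (intro exI[of _ "k - m"]) auto
      qed
      then show ?thesis by (simp add: frequently_sequentially funpow_add)
    qed
    from pb[OF that class_in_subspace[OF Tm this]]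
    have *: "lp_norm p M (T (n + m) \<phi>) / lp_norm p M (T m \<phi>) \<le> C"
      by (simp add: Lp_norm_wcomp_funpow_class[OF Tm] Lp_norm_class[OF Tm] funpow_add)
    \<comment> \<open>A zero denominator makes the quotient 0 by convention, so the quotient bound
      is then uninformative; boundedness of the single power \<open>T n\<close> covers that
      case.\<close>
    show ?thesis
    proof (cases "lp_norm p M (T m \<phi>) = 0")
      case True
      obtain L :: "nat \<Rightarrow> real" where
        "lp_norm p M (T n (T m \<phi>)) \<le> L n * lp_norm p M (T m \<phi>)"
        using lp_norm_T_bound Tm by metis
      with True show ?thesis by (simp add: funpow_add)
    next
      case False
      then have "0 < lp_norm p M (T m \<phi>)" by (simp add: lp_norm_nonneg less_le)
      with * show ?thesis by (simp add: pos_divide_le_eq)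
    qed
  qed
  have "(\<lambda>n. lp_norm p M (T n \<phi>)) \<longlonglongrightarrow> 0"
  proof (rule LIMSEQ_I)
    fix e :: real assume "0 < e"
    with C have "0 < e / C" by simp
    \<comment> \<open>One small time \<open>m\<close> controls the whole orbit after it.\<close>
    from frequently_ex[OF small[OF this]] obtain m where m: "C * lp_norm p M (T m \<phi>) < e"
      using C by (auto simp: field_simps)
    have "lp_norm p M (T n \<phi>) < e" if "m < n" for n
      using le[of "n - m" m] m that by fastforce
    then show "\<exists>N. \<forall>n\<ge>N. norm (lp_norm p M (T n \<phi>) - 0) < e"
      by (intro exI[of _ "Suc m"]) (simp add: lp_norm_nonneg)
  qed
  with nlim show False ..
qed

section \<open>From nonnegative functions back to vectors\<close>

text \<open>Measurability belongs to the conclusion because \<open>wcomp_cong_AE\<close> demands it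
  at each induction step.\<close>

lemma T_cong_AE:
  assumes "\<phi> \<in> borel_measurable M" "\<psi> \<in> borel_measurable M" "AE x in M. \<phi> x = \<psi> x"
  shows "T n \<phi> \<in> borel_measurable M \<and> T n \<psi> \<in> borel_measurable M \<and> (AE x in M. T n \<phi> x = T n \<psi> x)"
proof (induction n)
  case (Suc n)
  have "wcomp w f \<theta> \<in> borel_measurable M" if [measurable]: "\<theta> \<in> borel_measurable M" for \<theta>
    unfolding wcomp_def by measurable
  with Suc wcomp_cong_AE[OF W, of "T n \<phi>" "T n \<psi>"] show ?case by simp
qed (use assms in simp)

text \<open>Almost everywhere, either the iterated weight vanishes or the \<open>n\<close>-th
  iterate of the point avoids the exceptional set \<open>N\<close>. This follows from
  \<open>T_cong_AE\<close> for the indicator of \<open>N\<close>, which is almost everywhere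
  zero.\<close>

lemma J_cong_AE:
  assumes [measurable]: "u \<in> borel_measurable M" "v \<in> borel_measurable M" and "AE x in M. u x = v x"
  shows "J n u = J n v"
proof -
  define N where "N = {x \<in> space M. u x \<noteq> v x}"
  have [measurable]: "N \<in> sets M" unfolding N_def by measurable
  have "AE x in M. (indicator N x :: 'k) = 0"
    using assms(3) by eventually_elim (simp add: N_def)
  then have "AE x in M. T n (indicator N) x = T n (\<lambda>x. 0) x"
    using T_cong_AE[of "indicator N" "\<lambda>x. 0" n] by simp
  then have "AE x in M. iter_weight w f n x = 0 \<or> (f ^^ n) x \<notin> N"
    by eventually_elim (auto simp: wcomp_funpow indicator_def split: if_splits)
  with AE_space have "AE x in M. ennreal (norm (iter_weight w f n x) powr p) * u ((f ^^ n) x) =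
      ennreal (norm (iter_weight w f n x) powr p) * v ((f ^^ n) x)"
  proof eventually_elim
    case (elim x)
    have "(f ^^ n) x \<in> space M"
      using elim(1) measurable_space[OF funpow_measurable[OF f_measurable]] by blast
    with elim(2) show ?case by (auto simp: N_def)
  qed
  then show ?thesis unfolding J_def by (rule nn_integral_cong_AE)
qed

text \<open>The \<open>p\<close>-th root of \<open>u\<close> is a vector whose orbit norms have
  \<open>p\<close>-th powers \<open>J n u\<close>. Extended values are allowed because the hump
  limit is a pointwise supremum.\<close>

lemma semi_irregular_mass_imp_chaotic:
  assumes [measurable]: "u \<in> borel_measurable M" and fin: "(\<integral>\<^sup>+x. u x \<partial>M) < \<infinity>"
    and small: "\<And>e. 0 < e \<Longrightarrow> \<exists>\<^sub>F n in sequentially. J n u < e"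
    and nlim: "\<not> (\<lambda>n. J n u) \<longlonglongrightarrow> 0"
  shows "li_yorke_chaotic (Lp p M) (Lp_dist p M) (Lp_wcomp p M w f)"
proof -
  define \<phi> where "\<phi> = (\<lambda>x. of_real (enn2real (u x) powr (1 / p)) :: 'k)"
  have [measurable]: "\<phi> \<in> borel_measurable M" unfolding \<phi>_def by measurable
  have pow: "pow \<phi> x = ennreal (enn2real (u x))" for x
    using p by (simp add: \<phi>_def powr_powr)
  \<comment> \<open>\<open>enn2real\<close> sends infinity to 0; finiteness of the integral confines
    this change to a null set.\<close>
  have "AE x in M. u x \<noteq> \<infinity>" using fin by (intro nn_integral_PInf_AE) auto
  then have "AE x in M. pow \<phi> x = u x"
    by eventually_elim (simp add: pow ennreal_enn2real_if)
  then have J: "J n (pow \<phi>) = J n u" for n by (intro J_cong_AE) auto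
  have \<phi>: "\<phi> \<in> lp_fun p M" using fin J[of 0] by (simp add: lp_fun_iff J_0)
  show ?thesis
  proof (rule semi_irregular_imp_chaotic[OF \<phi>])
    show "\<exists>\<^sub>F n in sequentially. lp_norm p M (T n \<phi>) < e" if "0 < e" for e
      using frequently_J_pow_iff[OF \<phi>] small that by (simp add: J)
    show "\<not> (\<lambda>n. lp_norm p M (T n \<phi>)) \<longlonglongrightarrow> 0"
    proof
      assume "(\<lambda>n. lp_norm p M (T n \<phi>)) \<longlonglongrightarrow> 0"
      then have "(\<lambda>n. lp_norm p M (T n \<phi>) powr p) \<longlonglongrightarrow> 0"
        using p by (intro tendsto_zero_powrI[where b = p]) (auto simp: lp_norm_nonneg)
      then have "(\<lambda>n. ennreal (lp_norm p M (T n \<phi>) powr p)) \<longlonglongrightarrow> ennreal 0" by (rule tendsto_ennrealI)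
      with nlim show False by (simp add: J_pow[OF \<phi>, symmetric] J)
    qed
  qed
qed

section \<open>The gliding hump\<close>

text \<open>Rescaled humps have tiny mass yet reach size 1 at some time. Each is added at a moment
  when the orbit of the previous sum is small, so the total is small at infinitely many times and at
  least 1 at infinitely many others.\<close>

lemma gliding_hump:
  assumes big: "\<And>C. 0 < C \<Longrightarrow> \<exists>n u. u \<in> borel_measurable M \<and> (\<lambda>m. J m u) \<longlonglongrightarrow> 0 \<and>
    ennreal C * (\<integral>\<^sup>+x. u x \<partial>M) < J n u"
  obtains u where "u \<in> borel_measurable M" "(\<integral>\<^sup>+x. u x \<partial>M) < \<infinity>"
    "\<And>e. 0 < e \<Longrightarrow> \<exists>\<^sub>F n in sequentially. J n u < e" "\<not> (\<lambda>n. J n u) \<longlonglongrightarrow> 0"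
proof -
  obtain c where c: "1 \<le> c" and bound:
    "\<And>n u. u \<in> borel_measurable M \<Longrightarrow> J n u \<le> ennreal (c ^ n) * (\<integral>\<^sup>+x. u x \<partial>M)"
    using J_bound by blast
  have hump: "\<exists>n v. v \<in> borel_measurable M \<and> (\<lambda>m. J m v) \<longlonglongrightarrow> 0 \<and>
      (\<integral>\<^sup>+x. v x \<partial>M) \<le> ennreal e \<and> J n v = 1" if e: "0 < e" for e
  proof -
    from e have "0 < 1 / e" by simp
    from big[OF this] obtain n u where [measurable]: "u \<in> borel_measurable M"
      and lim: "(\<lambda>m. J m u) \<longlonglongrightarrow> 0" and gt: "ennreal (1 / e) * (\<integral>\<^sup>+x. u x \<partial>M) < J n u" by blast
    \<comment> \<open>Infinite mass would make the left side of \<open>gt\<close> infinite.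
      Finiteness passes on to \<open>J n u\<close>, so dividing by it is a genuine
      normalisation.\<close>
    have "(\<integral>\<^sup>+x. u x \<partial>M) < \<infinity>"
      using gt e by (auto simp: less_top[symmetric] ennreal_mult_eq_top_iff)
    then have "ennreal (c ^ n) * (\<integral>\<^sup>+x. u x \<partial>M) < \<infinity>" by (simp add: ennreal_mult_less_top)
    with bound[of u n] have J: "J n u < \<infinity>" "0 < J n u" using gt by (auto intro: le_less_trans)
    define k where "k = 1 / J n u"
    have k: "k < \<infinity>" "k * J n u = 1"
      using J by (auto simp: k_def divide_less_ennreal ennreal_divide_times ennreal_top_mult)
    have "(\<integral>\<^sup>+x. k * u x \<partial>M) = k * (\<integral>\<^sup>+x. u x \<partial>M)" by (rule nn_integral_cmult) measurable
    also have "\<dots> = ennreal (e * (1 / e)) * (k * (\<integral>\<^sup>+x. u x \<partial>M))" using e by simp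
    also have "\<dots> = ennreal e * (k * (ennreal (1 / e) * (\<integral>\<^sup>+x. u x \<partial>M)))"
      using e by (subst ennreal_mult) (auto simp: mult_ac)
    also have "\<dots> \<le> ennreal e * (k * J n u)" using gt by (intro mult_left_mono) auto
    finally have "(\<integral>\<^sup>+x. k * u x \<partial>M) \<le> ennreal e" using k by simp
    moreover have "(\<lambda>m. J m (\<lambda>x. k * u x)) \<longlonglongrightarrow> 0"
      using ennreal_tendsto_cmult[OF _ lim, of k] k by (simp add: J_cmult)
    moreover have "J n (\<lambda>x. k * u x) = 1" using k by (simp add: J_cmult)
    ultimately show ?thesis by (intro exI[of _ n] exI[of _ "\<lambda>x. k * u x"]) auto
  qed
  \<comment> \<open>A state is a partial sum \<open>s\<close> of humps and a time \<open>m\<close> at which its orbit is small. The next hump is so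
    small that it is negligible up to time \<open>m\<close>, which also forces its time of size 1 to be at least \<open>m\<close>.
    Time 0 in the initial state makes the bound at that time a bound for the integral of the limit.\<close>
  define P where "P k t = (case t of (s, m) \<Rightarrow> s \<in> borel_measurable M \<and> (\<lambda>n. J n s) \<longlonglongrightarrow> 0 \<and>
      J m s \<le> ennreal ((1 / 2) ^ k) \<and> k \<le> m \<and> (k = 0 \<longrightarrow> m = 0))" for k :: nat and t
  define Q where "Q k t t' = (case (t, t') of ((s, m), (s', m')) \<Rightarrow> m < m' \<and>
      (\<exists>v n. v \<in> borel_measurable M \<and> s' = (\<lambda>x. s x + v x) \<and>
        (\<integral>\<^sup>+x. v x \<partial>M) \<le> ennreal ((1 / 2) ^ Suc k / c ^ m) \<and> m \<le> n \<and> J n v = 1))" for k :: nat and t t'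
  have "\<exists>st. \<forall>k. P k (st k) \<and> Q k (st k) (st (Suc k))"
  proof (rule dependent_nat_choice)
    show "\<exists>t. P 0 t" by (rule exI[of _ "(\<lambda>x. 0, 0)"]) (simp add: P_def J_def)
  next
    fix t k assume P: "P k t"
    obtain s m where t: "t = (s, m)" by (cases t)
    from P have s [measurable]: "s \<in> borel_measurable M" and sl: "(\<lambda>n. J n s) \<longlonglongrightarrow> 0"
      by (auto simp: P_def t)
    define e where "e = (1 / 2) ^ Suc k / c ^ m"
    have "0 < e" using c by (simp add: e_def)
    from hump[OF this] obtain n v where v [measurable]: "v \<in> borel_measurable M"
      and vl: "(\<lambda>m. J m v) \<longlonglongrightarrow> 0" and ve: "(\<integral>\<^sup>+x. v x \<partial>M) \<le> ennreal e" and vn: "J n v = 1" by blast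
    have "m \<le> n"
    proof (rule ccontr)
      assume "\<not> m \<le> n"
      then have cc: "c ^ n \<le> c ^ m" using c by (intro power_increasing) auto
      have "ennreal 1 \<le> ennreal (c ^ n) * ennreal e"
        using bound[OF v, of n] ve vn mult_left_mono[OF ve, of "ennreal (c ^ n)"] by simp
      then have "1 \<le> c ^ n * e" using c \<open>0 < e\<close> by (simp add: ennreal_mult[symmetric])
      also have "\<dots> \<le> c ^ m * e" using cc \<open>0 < e\<close> by (intro mult_right_mono) auto
      also have "\<dots> = (1 / 2) ^ Suc k" using c by (simp add: e_def)
      also have "\<dots> < 1" by (intro power_Suc_less_one) auto
      finally show False by simp
    qed
    have "(\<lambda>n. J n (\<lambda>x. s x + v x)) \<longlonglongrightarrow> 0"
      using tendsto_add[OF sl vl] by (simp add: J_add)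
    from order_tendstoD(2)[OF this, of "ennreal ((1 / 2) ^ Suc k)"]
    have "\<forall>\<^sub>F n in sequentially. J n (\<lambda>x. s x + v x) < ennreal ((1 / 2) ^ Suc k)" by simp
    \<comment> \<open>The single demand \<open>m + Suc k \<le> n\<close> yields both
      \<open>m < m'\<close> for \<open>Q\<close> and \<open>Suc k \<le> m'\<close> for
      \<open>P\<close>.\<close>
    then have "\<forall>\<^sub>F n in sequentially. J n (\<lambda>x. s x + v x) < ennreal ((1 / 2) ^ Suc k) \<and> m + Suc k \<le> n"
      using eventually_ge_at_top by (rule eventually_conj)
    from eventually_happens'[OF sequentially_bot this] obtain m' where
      m': "J m' (\<lambda>x. s x + v x) < ennreal ((1 / 2) ^ Suc k)" "m + Suc k \<le> m'" by blast
    have "P (Suc k) (\<lambda>x. s x + v x, m')"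
      unfolding P_def using m' \<open>(\<lambda>n. J n (\<lambda>x. s x + v x)) \<longlonglongrightarrow> 0\<close> by auto
    moreover have "Q k t (\<lambda>x. s x + v x, m')"
      unfolding Q_def t prod.case using m' v ve[unfolded e_def] vn \<open>m \<le> n\<close>
      by (intro conjI exI[of _ v] exI[of _ n]) simp_all
    ultimately show "\<exists>t'. P (Suc k) t' \<and> Q k t t'" by blast
  qed
  then obtain st where st: "\<And>k. P k (st k)" "\<And>k. Q k (st k) (st (Suc k))" by blast
  define s where "s k = fst (st k)" for k
  define m where "m k = snd (st k)" for k
  have st_eq: "st k = (s k, m k)" for k by (simp add: s_def m_def)
  have s [measurable]: "s k \<in> borel_measurable M" and Jms: "J (m k) (s k) \<le> ennreal ((1 / 2) ^ k)"
    and km: "k \<le> m k" for k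
    using st(1)[of k] by (simp_all add: P_def st_eq)
  have m0: "m 0 = 0" using st(1)[of 0] by (simp add: P_def st_eq)
  define R where "R k v \<longleftrightarrow> v \<in> borel_measurable M \<and> s (Suc k) = (\<lambda>x. s k x + v x) \<and>
      (\<integral>\<^sup>+x. v x \<partial>M) \<le> ennreal ((1 / 2) ^ Suc k / c ^ m k) \<and> (\<exists>n\<ge>m k. J n v = 1)" for k v
  have mm: "m k < m (Suc k)" and "\<exists>v. R k v" for k
    using st(2)[of k] unfolding Q_def st_eq prod.case R_def by blast+
  then have "\<forall>k. \<exists>v. R k v" by blast
  from choice[OF this] obtain v where R: "\<And>k. R k (v k)" by blast
  have v [measurable]: "v k \<in> borel_measurable M" and s_Suc: "s (Suc k) = (\<lambda>x. s k x + v k x)"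
    and vm: "(\<integral>\<^sup>+x. v k x \<partial>M) \<le> ennreal ((1 / 2) ^ Suc k / c ^ m k)"
    and mn: "\<exists>n\<ge>m k. J n (v k) = 1" for k
    using R[of k] unfolding R_def by blast+
  have inc: "incseq s" by (rule incseq_SucI) (simp add: s_Suc le_fun_def add_increasing2)
  have "incseq m" by (rule incseq_SucI) (rule less_imp_le[OF mm])
  then have m_mono: "m k \<le> m l" if "k \<le> l" for k l using that by (rule incseqD)
  \<comment> \<open>The mass of hump \<open>l\<close> was divided by \<open>c ^ m l\<close>, which
    absorbs the growth up to time \<open>m l\<close> and hence up to every earlier
    \<open>m k\<close>.\<close>
  have Jmv: "J (m k) (v l) \<le> ennreal ((1 / 2) ^ Suc l)" if "k \<le> l" for k l
  proof -
    have "J (m k) (v l) \<le> ennreal (c ^ m k) * (\<integral>\<^sup>+x. v l x \<partial>M)" by (rule bound[OF v])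
    also have "\<dots> \<le> ennreal (c ^ m l) * ennreal ((1 / 2) ^ Suc l / c ^ m l)"
      by (rule mult_mono[OF ennreal_leI[OF power_increasing[OF m_mono[OF that] c]] vm]) simp_all
    also have "\<dots> = ennreal (c ^ m l * ((1 / 2) ^ Suc l / c ^ m l))"
      by (rule ennreal_mult[symmetric]) (use c in simp_all)
    also have "c ^ m l * ((1 / 2) ^ Suc l / c ^ m l) = (1 / 2) ^ Suc l" using c by simp
    finally show ?thesis .
  qed
  have Jmsd: "J (m k) (s (k + d)) + ennreal ((1 / 2) ^ (k + d)) \<le> ennreal (2 * (1 / 2) ^ k)" for k d
  proof (induction d)
    case 0
    have "J (m k) (s k) + ennreal ((1 / 2) ^ k) \<le> ennreal ((1 / 2) ^ k) + ennreal ((1 / 2) ^ k)"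
      by (intro add_mono Jms order_refl)
    also have "\<dots> = ennreal (2 * (1 / 2) ^ k)" by (subst ennreal_plus[symmetric]) auto
    finally show ?case by simp
  next
    case (Suc d)
    have "J (m k) (s (k + Suc d)) + ennreal ((1 / 2) ^ (k + Suc d)) =
        J (m k) (s (k + d)) + (J (m k) (v (k + d)) + ennreal ((1 / 2) ^ Suc (k + d)))"
      unfolding add_Suc_right s_Suc J_add[OF s v] add.assoc[of "J (m k) (s (k + d))"] ..
    also have "\<dots> \<le> J (m k) (s (k + d)) + (ennreal ((1 / 2) ^ Suc (k + d)) + ennreal ((1 / 2) ^ Suc (k + d)))"
      by (intro add_mono Jmv order_refl) auto
    also have "\<dots> = J (m k) (s (k + d)) + ennreal ((1 / 2) ^ (k + d))"
      by (subst ennreal_plus[symmetric]) auto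
    also note Suc
    finally show ?case .
  qed
  define u where "u = (\<lambda>x. SUP k. s k x)"
  have um [measurable]: "u \<in> borel_measurable M" unfolding u_def by measurable
  have Jmu: "J (m k) u \<le> ennreal (2 * (1 / 2) ^ k)" for k
  proof -
    have "J (m k) u = (SUP i. J (m k) (s i))" unfolding u_def by (rule J_SUP[OF inc s])
    also have "\<dots> \<le> ennreal (2 * (1 / 2) ^ k)"
    proof (rule SUP_least)
      fix i
      have "J (m k) (s i) \<le> J (m k) (s (k + i))"
        using incseqD[OF inc, of i "k + i"] by (intro J_mono) (simp add: le_fun_def)
      also have "\<dots> \<le> ennreal (2 * (1 / 2) ^ k)"
        using Jmsd[of k i] by (rule order_trans[rotated]) simp
      finally show "J (m k) (s i) \<le> ennreal (2 * (1 / 2) ^ k)" .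
    qed
    finally show ?thesis .
  qed
  have "\<exists>\<^sub>F i in sequentially. J i u < e" if "0 < e" for e
    unfolding frequently_sequentially
  proof
    fix N
    have "(\<lambda>k. 2 * (1 / 2 :: real) ^ k) \<longlonglongrightarrow> 2 * 0"
      by (intro tendsto_mult_left LIMSEQ_realpow_zero) auto
    then have "(\<lambda>k. ennreal (2 * (1 / 2) ^ k)) \<longlonglongrightarrow> 0"
      using tendsto_ennrealI by fastforce
    from order_tendstoD(2)[OF this that]
    have "\<forall>\<^sub>F k in sequentially. ennreal (2 * (1 / 2) ^ k) < e \<and> N \<le> k"
      using eventually_ge_at_top by (rule eventually_conj)
    from eventually_happens'[OF sequentially_bot this] obtain k
      where "ennreal (2 * (1 / 2) ^ k) < e" "N \<le> k" by blast
    then show "\<exists>i\<ge>N. J i u < e"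
      using Jmu[of k] km[of k] by (intro exI[of _ "m k"]) auto
  qed
  moreover have "\<not> (\<lambda>i. J i u) \<longlonglongrightarrow> 0"
  proof
    assume "(\<lambda>i. J i u) \<longlonglongrightarrow> 0"
    from order_tendstoD(2)[OF this, of 1] obtain N where N: "\<And>i. N \<le> i \<Longrightarrow> J i u < 1"
      by (auto simp: eventually_sequentially)
    \<comment> \<open>Hump \<open>N\<close> lies below the limit and reaches size 1 at some time
      from \<open>m N\<close> on, hence from \<open>N\<close> on.\<close>
    have "v N x \<le> u x" for x
      unfolding u_def by (rule SUP_upper2[of "Suc N"]) (auto simp: s_Suc)
    then have le: "J n (v N) \<le> J n u" for n by (rule J_mono)
    from mn obtain n where "m N \<le> n" "J n (v N) = 1" by blast
    with le[of n] km[of N] N[of n] show False by auto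
  qed
  \<comment> \<open>As \<open>m 0 = 0\<close> and \<open>J 0\<close> is the integral, the mass is at
    most 2.\<close>
  moreover have "(\<integral>\<^sup>+x. u x \<partial>M) < \<infinity>"
    using Jmu[of 0] by (simp add: m0 J_0 le_less_trans)
  ultimately show ?thesis using um that by blast
qed

section \<open>Orbits of finite combinations of generators\<close>

text \<open>A combination vanishes off the union of its sets and is bounded by the sum of the moduli
  of its coefficients. Since \<open>J n\<close> is additive, this pointwise domination reduces
  questions about \<open>g\<close> to finitely many indicators.\<close>

lemma span_sets_pow_le:
  assumes g: "g \<in> span_sets"
  obtains Bs and k :: real where "finite Bs" "Bs \<subseteq> liminf_null_sets p M w f"
    "\<And>x. pow g x \<le> ennreal k * (\<Sum>B\<in>Bs. indicator B x)" "g \<in> borel_measurable M"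
proof -
  obtain F c where F: "finite F" "F \<subseteq> (\<lambda>B. indicator B) ` liminf_null_sets p M w f"
    and g_def: "g = (\<lambda>x. \<Sum>\<phi>\<in>F. c \<phi> * \<phi> x)"
    using g unfolding span_sets_def by auto
  obtain Bs where Bs: "Bs \<subseteq> liminf_null_sets p M w f" "finite Bs" "F = (\<lambda>B. indicator B) ` Bs"
    using finite_subset_image[OF F] by blast
  define k where "k = (\<Sum>\<phi>\<in>F. norm (c \<phi>)) powr p"
  have "pow g x \<le> ennreal k * (\<Sum>B\<in>Bs. indicator B x)" for x
  proof (cases "\<exists>B\<in>Bs. x \<in> B")
    case True
    then obtain B where "B \<in> Bs" "x \<in> B" by blast
    then have "(1 :: ennreal) \<le> (\<Sum>B\<in>Bs. indicator B x)"
      using Bs(2) member_le_sum[of B Bs "\<lambda>B. indicator B x :: ennreal"] by simp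
    then have "ennreal k * 1 \<le> ennreal k * (\<Sum>B\<in>Bs. indicator B x)" by (intro mult_left_mono) auto
    moreover have "norm (g x) powr p \<le> k"
      unfolding k_def
    proof (rule powr_mono2)
      have "norm (g x) \<le> (\<Sum>\<phi>\<in>F. norm (c \<phi> * \<phi> x))" unfolding g_def by (rule norm_sum)
      also have "\<dots> \<le> (\<Sum>\<phi>\<in>F. norm (c \<phi>))"
        unfolding Bs(3) by (intro sum_mono) (auto simp: norm_mult indicator_def)
      finally show "norm (g x) \<le> (\<Sum>\<phi>\<in>F. norm (c \<phi>))" .
    qed (use p in auto)
    ultimately show ?thesis by (auto intro: order_trans ennreal_leI)
  next
    case False
    then have "g x = 0" unfolding g_def Bs(3) by (intro sum.neutral) auto
    then show ?thesis by simp
  qed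
  moreover have "g \<in> borel_measurable M"
    unfolding g_def using Bs by (intro borel_measurable_sum) (auto simp: liminf_null_sets_def)
  ultimately show ?thesis using that Bs by blast
qed

lemma span_sets_lp_fun:
  assumes "g \<in> span_sets"
  shows "g \<in> lp_fun p M"
proof -
  from assms obtain Bs and k :: real where Bs: "finite Bs" "Bs \<subseteq> liminf_null_sets p M w f"
    and le: "\<And>x. pow g x \<le> ennreal k * (\<Sum>B\<in>Bs. indicator B x)" and "g \<in> borel_measurable M"
    using span_sets_pow_le by blast
  have m [measurable]: "B \<in> sets M" if "B \<in> Bs" for B using that Bs(2) by (auto simp: liminf_null_sets_def)
  have "(\<integral>\<^sup>+x. pow g x \<partial>M) \<le> (\<integral>\<^sup>+x. ennreal k * (\<Sum>B\<in>Bs. indicator B x) \<partial>M)"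
    by (intro nn_integral_mono le)
  also have "\<dots> = ennreal k * (\<Sum>B\<in>Bs. emeasure M B)"
    by (simp add: nn_integral_cmult nn_integral_sum m)
  also have "\<dots> < \<infinity>"
    using Bs by (auto simp: ennreal_mult_less_top liminf_null_sets_def subset_iff)
  finally show ?thesis using \<open>g \<in> borel_measurable M\<close> by (simp add: lp_fun_iff)
qed

lemma span_sets_J_tendsto:
  assumes "g \<in> span_sets" and lim: "\<And>B. B \<in> liminf_null_sets p M w f \<Longrightarrow> (\<lambda>n. J n (indicator B)) \<longlonglongrightarrow> 0"
  shows "(\<lambda>n. J n (pow g)) \<longlonglongrightarrow> 0"
proof -
  from assms(1) obtain Bs and k :: real where Bs: "finite Bs" "Bs \<subseteq> liminf_null_sets p M w f"
    and le: "\<And>x. pow g x \<le> ennreal k * (\<Sum>B\<in>Bs. indicator B x)" "g \<in> borel_measurable M"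
    by (rule span_sets_pow_le) (rule that)
  have m: "B \<in> sets M" if "B \<in> Bs" for B using that Bs(2) by (auto simp: liminf_null_sets_def)
  have le_sum: "J n (pow g) \<le> ennreal k * (\<Sum>B\<in>Bs. J n (indicator B))" for n
  proof -
    have "J n (pow g) \<le> J n (\<lambda>x. ennreal k * (\<Sum>B\<in>Bs. indicator B x))" by (intro J_mono le)
    also have "\<dots> = ennreal k * J n (\<lambda>x. \<Sum>B\<in>Bs. indicator B x)"
      by (rule J_cmult) (intro borel_measurable_sum borel_measurable_indicator m)
    also have "J n (\<lambda>x. \<Sum>B\<in>Bs. indicator B x) = (\<Sum>B\<in>Bs. J n (indicator B))"
      by (rule J_sum) (intro borel_measurable_indicator m)
    finally show ?thesis .
  qed
  have "(\<lambda>n. ennreal k * (\<Sum>B\<in>Bs. J n (indicator B))) \<longlonglongrightarrow> 0"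
  proof -
    have "(\<lambda>n. \<Sum>B\<in>Bs. J n (indicator B)) \<longlonglongrightarrow> (\<Sum>B\<in>Bs. 0)"
      using Bs(2) by (intro tendsto_sum lim) auto
    from ennreal_tendsto_cmult[OF _ this, of "ennreal k"] show ?thesis by simp
  qed
  with tendsto_const show ?thesis
    by (rule tendsto_sandwich[rotated 2]) (simp_all add: le_sum)
qed

text \<open>The single power \<open>T n\<close> is continuous, so a strict violation of the bound
  \<open>C\<close> at a point of the closure persists at nearby points of the span.\<close>

lemma span_sets_unbounded:
  assumes npb: "\<not> power_bounded_in (Lp_norm p M) (Lp_wcomp p M w f) (liminf_null_subspace p M w f)"
    and C: "0 < C"
  shows "\<exists>n. \<exists>g\<in>span_sets. C * lp_norm p M g < lp_norm p M (T n g)"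
proof -
  obtain n z where z: "z \<in> liminf_null_subspace p M w f"
    and gt: "C < Lp_norm p M ((Lp_wcomp p M w f ^^ n) z) / Lp_norm p M z"
  proof -
    from npb C obtain n where
      "ennreal C < restrict_onorm (Lp_norm p M) (liminf_null_subspace p M w f) (Lp_wcomp p M w f ^^ n)"
      unfolding power_bounded_in_def by (auto simp: not_le)
    with C that show ?thesis
      unfolding restrict_onorm_def by (auto simp: less_SUP_iff ennreal_less_iff)
  qed
  define \<phi> where "\<phi> = lp_rep z"
  have zL: "z \<in> Lp p M" using z by (simp add: in_subspace_iff)
  have \<phi>: "\<phi> \<in> lp_fun p M" and z_eq: "z = lp_class p M \<phi>" using lp_rep[OF zL] by (auto simp: \<phi>_def)
  define a where "a = lp_norm p M \<phi>"
  define b where "b = lp_norm p M (T n \<phi>)"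
  have gt: "C < b / a"
    using gt by (simp add: z_eq Lp_norm_wcomp_funpow_class Lp_norm_class \<phi> a_def b_def)
  \<comment> \<open>Division by zero would give 0, which is not above \<open>C\<close>.\<close>
  have "a \<noteq> 0" using gt C by auto
  then have "0 < a" by (simp add: a_def lp_norm_nonneg less_le)
  with gt have ab: "C * a < b" by (simp add: pos_less_divide_eq)
  obtain L :: "nat \<Rightarrow> real" where L: "\<And>n. 0 \<le> L n"
    "\<And>n \<phi>. \<phi> \<in> lp_fun p M \<Longrightarrow> lp_norm p M (T n \<phi>) \<le> L n * lp_norm p M \<phi>"
    using lp_norm_T_bound by blast
  \<comment> \<open>Moving by \<open>r\<close> lowers the image norm by at most
    \<open>L n * r\<close> and raises \<open>C\<close> times the norm by at most
    \<open>C * r\<close>; for \<open>r < d\<close> the total stays below the gap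
    \<open>b - C * a\<close>.\<close>
  define d where "d = (b - C * a) / (L n + C)"
  have LC: "0 < L n + C" using L(1)[of n] C by simp
  with ab have "0 < d" by (simp add: d_def)
  with z obtain g where g: "g \<in> span_sets" and gd: "Lp_dist p M z (lp_class p M g) < d"
    by (auto simp: in_subspace_iff)
  have gL: "g \<in> lp_fun p M" by (rule span_sets_lp_fun[OF g])
  define r where "r = lp_norm p M (\<lambda>x. \<phi> x - g x)"
  have "r < d" using gd by (simp add: r_def z_eq Lp_dist_class[OF \<phi> gL])
  then have "r * (L n + C) < d * (L n + C)" using LC by (intro mult_strict_right_mono) auto
  then have r: "r * (L n + C) < b - C * a" using LC by (simp add: d_def)
  have diff: "(\<lambda>x. \<phi> x - g x) \<in> lp_fun p M" "(\<lambda>x. g x - \<phi> x) \<in> lp_fun p M"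
    by (intro lp_fun_diff p \<phi> gL)+
  have "b \<le> lp_norm p M (T n (\<lambda>x. \<phi> x - g x)) + lp_norm p M (T n g)"
    using lp_norm_triangle[OF p T_lp_fun[OF diff(1), of n] T_lp_fun[OF gL, of n]]
    by (simp add: T_diff b_def)
  also have "\<dots> \<le> L n * r + lp_norm p M (T n g)" unfolding r_def by (intro add_right_mono L diff)
  finally have 1: "b \<le> L n * r + lp_norm p M (T n g)" .
  have "lp_norm p M g \<le> r + a"
    using lp_norm_triangle[OF p diff(2) \<phi>] by (simp add: a_def r_def lp_norm_def norm_minus_commute)
  then have "C * lp_norm p M g \<le> C * (r + a)" using C by (intro mult_left_mono) auto
  with 1 r have "C * lp_norm p M g < lp_norm p M (T n g)" by (simp add: algebra_simps)
  with g show ?thesis by blast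
qed

section \<open>The converse implication and the equivalence\<close>

lemma not_power_bounded_imp_chaotic:
  assumes npb: "\<not> power_bounded_in (Lp_norm p M) (Lp_wcomp p M w f) (liminf_null_subspace p M w f)"
  shows "li_yorke_chaotic (Lp p M) (Lp_dist p M) (Lp_wcomp p M w f)"
proof (cases "\<exists>B\<in>liminf_null_sets p M w f. \<not> (\<lambda>n. J n (indicator B)) \<longlonglongrightarrow> 0")
  case True
  then obtain B where B: "B \<in> liminf_null_sets p M w f" "\<not> (\<lambda>n. J n (indicator B)) \<longlonglongrightarrow> 0" by blast
  then show ?thesis
    by (intro semi_irregular_mass_imp_chaotic[of "indicator B"]) (auto simp: liminf_null_sets_iff)
next
  case False
  show ?thesis
  proof (rule gliding_hump)
    fix C :: real assume "0 < C"
    \<comment> \<open>The hump condition compares \<open>p\<close>-th powers of norms, so the norms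
      are compared with the \<open>p\<close>-th root of \<open>C\<close>.\<close>
    then have "0 < C powr (1 / p)" by simp
    from span_sets_unbounded[OF npb this] obtain n g where g: "g \<in> span_sets"
      and gt: "C powr (1 / p) * lp_norm p M g < lp_norm p M (T n g)" by blast
    have gL: "g \<in> lp_fun p M" by (rule span_sets_lp_fun[OF g])
    have "(C powr (1 / p) * lp_norm p M g) powr p < lp_norm p M (T n g) powr p"
      using gt p by (intro powr_less_mono2) (auto simp: lp_norm_nonneg)
    then have "C * lp_norm p M g powr p < lp_norm p M (T n g) powr p"
      using p \<open>0 < C\<close> by (simp add: powr_mult powr_powr lp_norm_nonneg)
    then have "ennreal C * (\<integral>\<^sup>+x. pow g x \<partial>M) < J n (pow g)"
      using \<open>0 < C\<close> by (simp add: nn_integral_pow[OF gL] J_pow[OF gL] ennreal_mult[symmetric] ennreal_less_iff)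
    moreover have "(\<lambda>m. J m (pow g)) \<longlonglongrightarrow> 0" by (rule span_sets_J_tendsto[OF g]) (use False in blast)
    moreover have "pow g \<in> borel_measurable M" using lp_fun_measurable[OF gL] by measurable
    ultimately show "\<exists>n u. u \<in> borel_measurable M \<and> (\<lambda>m. J m u) \<longlonglongrightarrow> 0 \<and>
      ennreal C * (\<integral>\<^sup>+x. u x \<partial>M) < J n u" by blast
  qed (rule semi_irregular_mass_imp_chaotic)
qed

lemma chaotic_iff_not_power_bounded:
  "li_yorke_chaotic (Lp p M) (Lp_dist p M) (Lp_wcomp p M w f) \<longleftrightarrow>
    \<not> power_bounded_in (Lp_norm p M) (Lp_wcomp p M w f) (liminf_null_subspace p M w f)"
  using chaotic_imp_not_power_bounded not_power_bounded_imp_chaotic by blast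

end

theorem theorem9:
  fixes p :: real and M :: "'a measure" and f :: "'a \<Rightarrow> 'a"
  assumes "1 \<le> p"
  shows "(\<forall>w :: 'a \<Rightarrow> real. weighted_composition p M w f \<longrightarrow>
            (li_yorke_chaotic (Lp p M) (Lp_dist p M) (Lp_wcomp p M w f) \<longleftrightarrow>
             \<not> power_bounded_in (Lp_norm p M) (Lp_wcomp p M w f) (liminf_null_subspace p M w f)))
       \<and> (\<forall>w :: 'a \<Rightarrow> complex. weighted_composition p M w f \<longrightarrow>
            (li_yorke_chaotic (Lp p M) (Lp_dist p M) (Lp_wcomp p M w f) \<longleftrightarrow>
             \<not> power_bounded_in (Lp_norm p M) (Lp_wcomp p M w f) (liminf_null_subspace p M w f)))"
  by (intro conjI allI impI)
    (rule wcomp_operator.chaotic_iff_not_power_bounded[OF wcomp_operator.intro, OF assms], assumption)+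

end
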